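(* Let $\lambda$ be a singular cardinal and let $D$ be a $(\operatorname{cf}\lambda)^+$-complete ultrafilter such that there exists $\lambda'<\lambda$ with $D$ being $\kappa$-decomposable for every regular cardinal $\kappa$ with $\lambda'\le\kappa<\lambda$. Then $D$ is $\lambda^+$-decomposable, and moreover $\operatorname{pp}(\lambda)=\lambda^+$.
   Context: An ultrafilter $D$ over a set $I$ is $\lambda$-decomposable if there is a partition of $I$ into $\lambda$ sets such that the union of any fewer than $\lambda$ sets of the partition never belongs to $D$. $D$ is $\theta$-complete if it is closed under intersections of fewer than $\theta$ of its members. For singular $\lambda$, $\operatorname{pp}(\lambda)$ (Shelah's pseudopower) is the supremum of the cofinalities of the linear orders $\prod_{\kappa\in\mathfrak a}\kappa/E$, where $\mathfrak a$ ranges over sets of regular cardinals below $\lambda$, unbounded in $\lambda$, with $|\mathfrak a|\le\operatorname{cf}\lambda$, and $E$ ranges over ultrafilters on $\mathfrak a$ containing no bounded subset of $\lambda$ (and such that the ultraproduct has true cofinality). *)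

theory Defs
  imports Main "HOL-Library.FuncSet" "HOL-Library.Disjoint_Sets"
begin

unbundle cardinal_syntax

text \<open>
  Cardinals are, as in the library, well-orders satisfying \<^const>\<open>Card_order\<close>, and equality of
  cardinals is order isomorphism \<open>=o\<close>.  If \<open>r :: 'a rel\<close> is a cardinal \<open>\<lambda>\<close>, the elements of
  \<^term>\<open>Field r\<close> play the role of the ordinals below \<open>\<lambda>\<close>: the element \<open>x\<close> stands for the ordinal
  whose well-order is the restriction of \<open>r\<close> to the strict predecessors of \<open>x\<close>.  Every cardinal
  below \<open>\<lambda>\<close> has an isomorphic copy on the same type \<open>'a\<close>.
\<close>

definition initial_ordinal :: "'a rel \<Rightarrow> 'a \<Rightarrow> 'a rel" where
  "initial_ordinal r x = Restr r (underS r x)"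

definition regular_cardinal :: "'a rel \<Rightarrow> bool" where
  "regular_cardinal r \<longleftrightarrow> Cinfinite r \<and> regularCard r"

definition singular_cardinal :: "'a rel \<Rightarrow> bool" where
  "singular_cardinal r \<longleftrightarrow> Cinfinite r \<and> \<not> regularCard r"

definition least_cardinal :: "'a rel set \<Rightarrow> 'a rel" where
  "least_cardinal R = (SOME r. r \<in> R \<and> (\<forall>s\<in>R. r \<le>o s))"

text \<open>
  The library predicate \<^const>\<open>cofinal\<close> asks for strict upper bounds.  The notion below is only
  meant for linear orders without a greatest element, where this is the same as asking for
  non-strict ones; infinite cardinals and ultraproducts of them are of this kind.
\<close>

definition cofinality :: "'a rel \<Rightarrow> 'a rel" where
  "cofinality r = least_cardinal {|K| | K. K \<subseteq> Field r \<and> cofinal K r}"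

text \<open>
  The upper bounds are taken on the same type as the members of \<open>R\<close>; lemmas
  \<open>cardinal_Sup_upper\<close> and \<open>cardinal_Sup_least\<close> show that this is the supremum among cardinals
  on arbitrary types.
\<close>

definition cardinal_Sup :: "'a rel set \<Rightarrow> 'a rel" where
  "cardinal_Sup R = least_cardinal {t. Card_order t \<and> (\<forall>s\<in>R. s \<le>o t)}"

definition ultrafilter_on :: "'i set \<Rightarrow> 'i set set \<Rightarrow> bool" where
  "ultrafilter_on I D \<longleftrightarrow>
     D \<subseteq> Pow I \<and> I \<in> D \<and> {} \<notin> D \<and>
     (\<forall>X\<in>D. \<forall>Y. X \<subseteq> Y \<and> Y \<subseteq> I \<longrightarrow> Y \<in> D) \<and>
     (\<forall>X\<in>D. \<forall>Y\<in>D. X \<inter> Y \<in> D) \<and>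
     (\<forall>X. X \<subseteq> I \<longrightarrow> X \<in> D \<or> I - X \<in> D)"

definition complete_filter :: "'k rel \<Rightarrow> 'i set set \<Rightarrow> bool" where
  "complete_filter \<theta> D \<longleftrightarrow> (\<forall>S. S \<subseteq> D \<and> S \<noteq> {} \<and> |S| <o \<theta> \<longrightarrow> \<Inter>S \<in> D)"

definition decomposable :: "'k rel \<Rightarrow> 'i set \<Rightarrow> 'i set set \<Rightarrow> bool" where
  "decomposable \<kappa> I D \<longleftrightarrow>
     (\<exists>P. partition_on I P \<and> |P| =o \<kappa> \<and> (\<forall>Q. Q \<subseteq> P \<and> |Q| <o \<kappa> \<longrightarrow> \<Union>Q \<notin> D))"

definition ultraproduct_eq :: "'i set \<Rightarrow> 'i set set \<Rightarrow> ('i \<Rightarrow> 'b rel) \<Rightarrow> ('i \<Rightarrow> 'b) rel" where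
  "ultraproduct_eq A E s =
     {(f, g). f \<in> (\<Pi>\<^sub>E x\<in>A. Field (s x)) \<and> g \<in> (\<Pi>\<^sub>E x\<in>A. Field (s x)) \<and>
              {x\<in>A. f x = g x} \<in> E}"

definition ultraproduct :: "'i set \<Rightarrow> 'i set set \<Rightarrow> ('i \<Rightarrow> 'b rel) \<Rightarrow> ('i \<Rightarrow> 'b) set rel" where
  "ultraproduct A E s =
     {(X, Y). X \<in> (\<Pi>\<^sub>E x\<in>A. Field (s x)) // ultraproduct_eq A E s \<and>
              Y \<in> (\<Pi>\<^sub>E x\<in>A. Field (s x)) // ultraproduct_eq A E s \<and>
              (\<exists>f\<in>X. \<exists>g\<in>Y. {x\<in>A. (f x, g x) \<in> s x} \<in> E)}"

text \<open>
  The sets \<open>A\<close> of the definition of the pseudopower are sets of elements \<open>x\<close> of \<^term>\<open>Field r\<close> whose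
  ordinals are regular cardinals; a subset of \<^term>\<open>Field r\<close> is unbounded iff it is
  \<^const>\<open>cofinal\<close>.  Existence of the true cofinality is no restriction, because an ultraproduct
  of linear orders is linear.
\<close>

definition pp_pair :: "'a rel \<Rightarrow> 'a set \<Rightarrow> 'a set set \<Rightarrow> bool" where
  "pp_pair r A E \<longleftrightarrow>
     A \<subseteq> Field r \<and> (\<forall>x\<in>A. regular_cardinal (initial_ordinal r x)) \<and>
     cofinal A r \<and> |A| \<le>o cofinality r \<and>
     ultrafilter_on A E \<and> (\<forall>B\<in>E. cofinal B r)"

definition pp :: "'a rel \<Rightarrow> ('a \<Rightarrow> 'a) set rel" where
  "pp r = cardinal_Sup {cofinality (ultraproduct A E (initial_ordinal r)) | A E. pp_pair r A E}"

lemma least_cardinal: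
  assumes "R \<noteq> {}" "\<forall>r\<in>R. Card_order r"
  shows "least_cardinal R \<in> R" and "\<And>s. s \<in> R \<Longrightarrow> least_cardinal R \<le>o s"
proof -
  have "\<exists>r. r \<in> R \<and> (\<forall>s\<in>R. r \<le>o s)"
    using exists_minim_Card_order[OF assms] by blast
  hence "least_cardinal R \<in> R \<and> (\<forall>s\<in>R. least_cardinal R \<le>o s)"
    unfolding least_cardinal_def by (rule someI_ex)
  thus "least_cardinal R \<in> R" and "\<And>s. s \<in> R \<Longrightarrow> least_cardinal R \<le>o s" by blast+
qed

lemma cofinality_witness:
  assumes "cofinal (Field r) r"
  obtains K where "K \<subseteq> Field r" "cofinal K r" "cofinality r = |K|"
proof -
  let ?R = "{|K| | K. K \<subseteq> Field r \<and> cofinal K r}"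
  have "cofinality r \<in> ?R"
    unfolding cofinality_def
    by (rule least_cardinal(1)) (use assms card_of_Card_order in blast)+
  thus ?thesis using that by blast
qed

lemma cofinality_le:
  assumes "K \<subseteq> Field r" "cofinal K r"
  shows "cofinality r \<le>o |K|"
proof -
  let ?R = "{|K| | K. K \<subseteq> Field r \<and> cofinal K r}"
  show ?thesis
    unfolding cofinality_def
    by (rule least_cardinal(2)) (use assms card_of_Card_order in blast)+
qed

lemma cardinal_Sup_in:
  fixes R :: "'a rel set"
  assumes "\<forall>s\<in>R. Card_order s"
  shows "Card_order (cardinal_Sup R)" and cardinal_Sup_upper: "\<And>s. s \<in> R \<Longrightarrow> s \<le>o cardinal_Sup R"
proof -
  let ?T = "{t :: 'a rel. Card_order t \<and> (\<forall>s\<in>R. s \<le>o t)}"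
  have "s \<le>o |UNIV :: 'a set|" if "s \<in> R" for s
  proof -
    have "|Field s| =o s" using assms that card_of_Field_ordIso by blast
    moreover have "|Field s| \<le>o |UNIV :: 'a set|" by (simp add: card_of_mono1)
    ultimately show ?thesis using ordIso_ordLeq_trans ordIso_symmetric by blast
  qed
  hence "|UNIV :: 'a set| \<in> ?T" using card_of_Card_order by blast
  hence "cardinal_Sup R \<in> ?T"
    unfolding cardinal_Sup_def by (intro least_cardinal(1)) blast+
  thus "Card_order (cardinal_Sup R)" and "\<And>s. s \<in> R \<Longrightarrow> s \<le>o cardinal_Sup R" by blast+
qed

lemma cardinal_Sup_least:
  fixes R :: "'a rel set" and t :: "'b rel"
  assumes R: "\<forall>s\<in>R. Card_order s" and t: "Card_order t" "\<forall>s\<in>R. s \<le>o t"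
  shows "cardinal_Sup R \<le>o t"
proof (rule ccontr)
  assume "\<not> ?thesis"
  hence less: "t <o cardinal_Sup R"
    using t(1) cardinal_Sup_in(1)[OF R] by (metis card_order_on_well_order_on not_ordLeq_iff_ordLess)
  then obtain u :: "'a rel" where u: "t =o u" "u <o cardinal_Sup R"
    using internalize_ordLess[of t "cardinal_Sup R"] by blast
  have "Card_order u" "\<forall>s\<in>R. s \<le>o u"
    using u(1) t Card_order_ordIso2 ordLeq_ordIso_trans by blast+
  hence "cardinal_Sup R \<le>o u"
    unfolding cardinal_Sup_def by (intro least_cardinal(2)) blast+
  thus False using u(2) not_ordLess_ordLeq by blast
qed

lemma ultrafilter_on_Int:
  "ultrafilter_on I D \<Longrightarrow> X \<in> D \<Longrightarrow> Y \<in> D \<Longrightarrow> X \<inter> Y \<in> D"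
  unfolding ultrafilter_on_def by blast

lemma ultrafilter_on_mono:
  "ultrafilter_on I D \<Longrightarrow> X \<in> D \<Longrightarrow> X \<subseteq> Y \<Longrightarrow> Y \<subseteq> I \<Longrightarrow> Y \<in> D"
  unfolding ultrafilter_on_def by blast

lemma ultrafilter_on_cases:
  "ultrafilter_on I D \<Longrightarrow> X \<subseteq> I \<Longrightarrow> X \<in> D \<or> I - X \<in> D"
  unfolding ultrafilter_on_def by simp

lemma equiv_ultraproduct_eq:
  assumes U: "ultrafilter_on A E"
  shows "equiv (\<Pi>\<^sub>E x\<in>A. Field (s x)) (ultraproduct_eq A E s)"
proof (rule equivI)
  have "A \<in> E" using U unfolding ultrafilter_on_def by blast
  thus "refl_on (\<Pi>\<^sub>E x\<in>A. Field (s x)) (ultraproduct_eq A E s)"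
    unfolding refl_on_def ultraproduct_eq_def by simp
  show "ultraproduct_eq A E s \<subseteq> (\<Pi>\<^sub>E x\<in>A. Field (s x)) \<times> (\<Pi>\<^sub>E x\<in>A. Field (s x))"
    unfolding ultraproduct_eq_def by blast
  show "sym (ultraproduct_eq A E s)"
    unfolding sym_def ultraproduct_eq_def by (simp add: eq_commute)
  show "trans (ultraproduct_eq A E s)"
  proof (rule transI)
    fix f g h
    assume a: "(f, g) \<in> ultraproduct_eq A E s" "(g, h) \<in> ultraproduct_eq A E s"
    hence "{x\<in>A. f x = g x} \<inter> {x\<in>A. g x = h x} \<in> E"
      using ultrafilter_on_Int[OF U] unfolding ultraproduct_eq_def by blast
    hence "{x\<in>A. f x = h x} \<in> E"
      by (rule ultrafilter_on_mono[OF U]) auto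
    thus "(f, h) \<in> ultraproduct_eq A E s"
      using a unfolding ultraproduct_eq_def by blast
  qed
qed

lemma ultraproduct_iff:
  assumes U: "ultrafilter_on A E"
    and f: "f \<in> (\<Pi>\<^sub>E x\<in>A. Field (s x))" and g: "g \<in> (\<Pi>\<^sub>E x\<in>A. Field (s x))"
  shows "(ultraproduct_eq A E s `` {f}, ultraproduct_eq A E s `` {g}) \<in> ultraproduct A E s
           \<longleftrightarrow> {x\<in>A. (f x, g x) \<in> s x} \<in> E"
    (is "?L \<longleftrightarrow> ?R")
proof
  assume ?L
  then obtain f' g' where 1: "(f, f') \<in> ultraproduct_eq A E s" "(g, g') \<in> ultraproduct_eq A E s"
    and 2: "{x\<in>A. (f' x, g' x) \<in> s x} \<in> E"
    unfolding ultraproduct_def by blast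
  have "{x\<in>A. f x = f' x} \<inter> {x\<in>A. g x = g' x} \<inter> {x\<in>A. (f' x, g' x) \<in> s x} \<in> E"
    by (intro ultrafilter_on_Int[OF U] 2) (use 1 in \<open>auto simp: ultraproduct_eq_def\<close>)
  thus ?R by (rule ultrafilter_on_mono[OF U]) auto
next
  assume R: ?R
  have "f \<in> ultraproduct_eq A E s `` {f}" "g \<in> ultraproduct_eq A E s `` {g}"
    using equiv_class_self[OF equiv_ultraproduct_eq[OF U]] f g by blast+
  thus ?L
    unfolding ultraproduct_def using R quotientI[OF f] quotientI[OF g] by blast
qed

lemma Linear_order_ultraproduct:
  assumes U: "ultrafilter_on A E" and lin: "\<And>x. x \<in> A \<Longrightarrow> Linear_order (s x)"
  shows "Field (ultraproduct A E s) = (\<Pi>\<^sub>E x\<in>A. Field (s x)) // ultraproduct_eq A E s"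
    and "Linear_order (ultraproduct A E s)"
proof -
  let ?P = "\<Pi>\<^sub>E x\<in>A. Field (s x)"
  let ?c = "\<lambda>f. ultraproduct_eq A E s `` {f}"
  let ?r = "ultraproduct A E s"
  have A: "A \<in> E" using U unfolding ultrafilter_on_def by blast
  have iff: "(?c f, ?c g) \<in> ?r \<longleftrightarrow> {x\<in>A. (f x, g x) \<in> s x} \<in> E" if "f \<in> ?P" "g \<in> ?P" for f g
    using ultraproduct_iff[OF U that] .
  have refl: "(?c f, ?c f) \<in> ?r" if f: "f \<in> ?P" for f
  proof -
    have "(f x, f x) \<in> s x" if x: "x \<in> A" for x
    proof -
      have "Refl (s x)" using lin[OF x] unfolding order_on_defs by blast
      thus ?thesis using f x by (auto simp: refl_on_def PiE_def Pi_def)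
    qed
    hence "{x\<in>A. (f x, f x) \<in> s x} = A" by blast
    thus ?thesis using A ultraproduct_iff[OF U f f] by simp
  qed
  show F: "Field ?r = ?P // ultraproduct_eq A E s"
  proof
    show "Field ?r \<subseteq> ?P // ultraproduct_eq A E s"
      unfolding Field_def ultraproduct_def by blast
    show "?P // ultraproduct_eq A E s \<subseteq> Field ?r"
      using refl by (auto elim!: quotientE intro: FieldI1)
  qed
  have "Refl ?r" unfolding refl_on_def F using refl by (auto elim!: quotientE)
  moreover have "trans ?r"
  proof (rule transI)
    fix X Y Z assume XY: "(X, Y) \<in> ?r" and YZ: "(Y, Z) \<in> ?r"
    hence "X \<in> ?P // ultraproduct_eq A E s" "Y \<in> ?P // ultraproduct_eq A E s"
      "Z \<in> ?P // ultraproduct_eq A E s" unfolding ultraproduct_def by blast+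
    then obtain f g h where f: "f \<in> ?P" "X = ?c f" and g: "g \<in> ?P" "Y = ?c g"
      and h: "h \<in> ?P" "Z = ?c h" by (auto elim!: quotientE)
    have "{x\<in>A. (f x, g x) \<in> s x} \<inter> {x\<in>A. (g x, h x) \<in> s x} \<in> E"
      using XY YZ iff[OF f(1) g(1)] iff[OF g(1) h(1)] unfolding f(2) g(2) h(2)
      by (intro ultrafilter_on_Int[OF U]) blast+
    moreover have "{x\<in>A. (f x, g x) \<in> s x} \<inter> {x\<in>A. (g x, h x) \<in> s x} \<subseteq> {x\<in>A. (f x, h x) \<in> s x}"
    proof -
      have "trans (s x)" if "x \<in> A" for x using lin[OF that] unfolding order_on_defs by blast
      thus ?thesis unfolding trans_def by blast
    qed
    ultimately have "{x\<in>A. (f x, h x) \<in> s x} \<in> E"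
      by (rule ultrafilter_on_mono[OF U]) auto
    thus "(X, Z) \<in> ?r" using iff[OF f(1) h(1)] unfolding f(2) h(2) by blast
  qed
  moreover have "antisym ?r"
  proof (rule antisymI)
    fix X Y assume XY: "(X, Y) \<in> ?r" and YX: "(Y, X) \<in> ?r"
    hence "X \<in> ?P // ultraproduct_eq A E s" "Y \<in> ?P // ultraproduct_eq A E s"
      unfolding ultraproduct_def by blast+
    then obtain f g where f: "f \<in> ?P" "X = ?c f" and g: "g \<in> ?P" "Y = ?c g"
      by (auto elim!: quotientE)
    have "{x\<in>A. (f x, g x) \<in> s x} \<inter> {x\<in>A. (g x, f x) \<in> s x} \<in> E"
      using XY YX iff[OF f(1) g(1)] iff[OF g(1) f(1)] unfolding f(2) g(2)
      by (intro ultrafilter_on_Int[OF U]) blast+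
    moreover have "{x\<in>A. (f x, g x) \<in> s x} \<inter> {x\<in>A. (g x, f x) \<in> s x} \<subseteq> {x\<in>A. f x = g x}"
    proof -
      have "antisym (s x)" if "x \<in> A" for x using lin[OF that] unfolding order_on_defs by blast
      thus ?thesis unfolding antisym_def by blast
    qed
    ultimately have "{x\<in>A. f x = g x} \<in> E"
      by (rule ultrafilter_on_mono[OF U]) auto
    hence "(f, g) \<in> ultraproduct_eq A E s" using f g unfolding ultraproduct_eq_def by blast
    thus "X = Y" unfolding f(2) g(2) by (rule equiv_class_eq[OF equiv_ultraproduct_eq[OF U]])
  qed
  moreover have "Total ?r"
    unfolding total_on_def F
  proof (intro ballI impI)
    fix X Y assume "X \<in> ?P // ultraproduct_eq A E s" "Y \<in> ?P // ultraproduct_eq A E s"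
    then obtain f g where f: "f \<in> ?P" "X = ?c f" and g: "g \<in> ?P" "Y = ?c g"
      by (auto elim!: quotientE)
    have "(f x, g x) \<in> s x \<or> (g x, f x) \<in> s x" if x: "x \<in> A" for x
    proof -
      have "f x \<in> Field (s x)" "g x \<in> Field (s x)" using f g x by (auto simp: PiE_def Pi_def)
      moreover have "Refl (s x)" "Total (s x)" using lin[OF x] unfolding order_on_defs by blast+
      ultimately show ?thesis unfolding refl_on_def total_on_def by metis
    qed
    hence sub: "A - {x\<in>A. (f x, g x) \<in> s x} \<subseteq> {x\<in>A. (g x, f x) \<in> s x}" by blast
    have "{x\<in>A. (f x, g x) \<in> s x} \<in> E \<or> A - {x\<in>A. (f x, g x) \<in> s x} \<in> E"
      by (rule ultrafilter_on_cases[OF U]) simp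
    hence "{x\<in>A. (f x, g x) \<in> s x} \<in> E \<or> {x\<in>A. (g x, f x) \<in> s x} \<in> E"
      using ultrafilter_on_mono[OF U _ sub] by fastforce
    thus "(X, Y) \<in> ?r \<or> (Y, X) \<in> ?r" using iff[OF f(1) g(1)] iff[OF g(1) f(1)] unfolding f(2) g(2) by blast
  qed
  moreover have "?r \<subseteq> Field ?r \<times> Field ?r" by (auto intro: FieldI1 FieldI2)
  ultimately show "Linear_order ?r" unfolding order_on_defs by blast
qed

end

theory Submission
  imports Defs
begin

text \<open>
  Fix a set \<open>A\<close> of regular cardinals cofinal in \<open>\<lambda>\<close>, \<open>|A| \<le> cf \<lambda>\<close>, and an ultrafilter \<open>E\<close> on \<open>A\<close>
  without bounded sets.  Families of at most \<open>\<lambda>\<close> functions in \<open>\<Prod>A\<close> are bounded modulo \<open>E\<close>, so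
  \<open>cf (\<Prod>A/E) \<ge> \<lambda>\<^sup>+\<close>.  The main point is that \<open>cf (\<Prod>A/E) > \<lambda>\<^sup>+\<close> is impossible.  If it held, all families
  of \<open>\<lambda>\<^sup>+\<close> functions would be bounded, and one could write every \<open>\<gamma> < \<lambda>\<^sup>+\<close> as a union of sets \<open>B \<gamma> \<xi>\<close>
  (\<open>\<xi> \<in> A\<close>) of size less than \<open>\<lambda>\<close> and choose \<open>f\<^sub>\<beta>\<close>, \<open>\<beta> < \<lambda>\<^sup>+\<close>, above the pointwise suprema of
  \<open>{f\<^sub>\<alpha> | \<alpha> \<in> B \<gamma> \<xi>, \<alpha> < \<beta>}\<close> for all \<open>\<gamma>, \<xi>\<close> simultaneously.

  The completeness of \<open>D\<close> makes every function from the index set of \<open>D\<close> to the power set of \<open>A\<close>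
  constant on a set in \<open>D\<close>; hence \<open>2\<^bsup>|A|\<^esup> < \<rho>\<close> for every regular \<open>\<rho>\<close> below \<open>\<lambda>\<close> at which \<open>D\<close> is
  decomposable.  If \<open>D\<close> were \<open>\<lambda>\<^sup>+\<close>-decomposable, this would yield \<open>\<lambda>\<^sup>+\<close> many \<open>f\<^sub>\<alpha>\<close> that are pointwise
  increasing on one set of \<open>E\<close>, which is absurd.  Otherwise every upper bound of the sequence
  has another one strictly below it: either through small cofinal sets, with which the sequence cannot be
  interleaved, or through decompositions of \<open>D\<close>.  The same holds below any family of fewer
  than \<open>\<rho>\<close> upper bounds, so there is a strictly decreasing \<open>\<rho>\<close>-sequence of upper bounds modulo \<open>E\<close>;
  this contradicts the \<open>\<rho>\<close>-decomposability of \<open>D\<close>.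

  So \<open>cf (\<Prod>A/E) = \<lambda>\<^sup>+\<close> for all \<open>A\<close> and \<open>E\<close>, that is \<open>pp \<lambda> = \<lambda>\<^sup>+\<close>; and a cofinal family of \<open>\<lambda>\<^sup>+\<close> functions
  together with decompositions of \<open>D\<close> at the members of \<open>A\<close> gives a decomposition of \<open>D\<close> at \<open>\<lambda>\<^sup>+\<close>.
\<close>

section \<open>Well-orders and filters\<close>

lemma underS_iff: "x \<in> underS r y \<longleftrightarrow> x \<noteq> y \<and> (x, y) \<in> r"
  by (simp add: underS_def)

lemma underS_FieldI: "x \<in> underS r y \<Longrightarrow> x \<in> Field r" and underS_FieldI2: "x \<in> underS r y \<Longrightarrow> y \<in> Field r"
  by (auto simp: underS_def Field_def)

lemma underS_subset_Field: "underS r y \<subseteq> Field r"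
  by (auto intro: underS_FieldI)

lemma Un_singleton_ordLess:
  assumes r: "Card_order r" "\<not> finite (Field r)" and X: "|X| <o r"
  shows "|X \<union> {a}| <o r"
proof (rule card_of_Un_ordLess_infinite_Field[OF r(2,1) X])
  show "|{a}| <o r"
    using r by (intro finite_ordLess_infinite card_of_Well_order) (simp_all add: Field_card_of card_order_on_def)
qed

locale well_ordered =
  fixes r :: "'c rel"
  assumes Wo: "Well_order r"
begin

lemma trans: "trans r" and antisym: "antisym r" and wf: "wf (r - Id)"
  using Wo unfolding order_on_defs well_order_on_def by simp_all

lemma refl: "x \<in> Field r \<Longrightarrow> (x, x) \<in> r"
  using Wo unfolding order_on_defs well_order_on_def refl_on_def by simp

lemma total: "x \<in> Field r \<Longrightarrow> y \<in> Field r \<Longrightarrow> (x, y) \<in> r \<or> (y, x) \<in> r"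
  using wo_rel.TOTALS[unfolded wo_rel_def, OF Wo] by simp

lemma le_trans: "(x, y) \<in> r \<Longrightarrow> (y, z) \<in> r \<Longrightarrow> (x, z) \<in> r"
  using trans by (rule transD)

lemma lt_le_trans: "x \<in> underS r y \<Longrightarrow> (y, z) \<in> r \<Longrightarrow> x \<in> underS r z"
  unfolding underS_iff using le_trans antisymD[OF antisym] by blast

lemma le_lt_trans: "(x, y) \<in> r \<Longrightarrow> y \<in> underS r z \<Longrightarrow> x \<in> underS r z"
  unfolding underS_iff using le_trans antisymD[OF antisym] by blast

lemma lt_trans: "x \<in> underS r y \<Longrightarrow> y \<in> underS r z \<Longrightarrow> x \<in> underS r z"
  using le_lt_trans unfolding underS_iff by blast

lemma not_lt: "x \<in> Field r \<Longrightarrow> y \<in> Field r \<Longrightarrow> x \<notin> underS r y \<longleftrightarrow> (y, x) \<in> r"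
  unfolding underS_iff using total refl antisymD[OF antisym] by blast

lemma lt_not_le: "x \<in> underS r y \<Longrightarrow> (y, x) \<notin> r"
  unfolding underS_iff using antisymD[OF antisym] by blast

lemma lt_imp_le: "x \<in> underS r y \<Longrightarrow> (x, y) \<in> r"
  unfolding underS_iff by blast

lemma least_exists:
  assumes "S \<subseteq> Field r" "S \<noteq> {}"
  shows "\<exists>m\<in>S. \<forall>x\<in>S. (m, x) \<in> r"
proof -
  obtain s where "s \<in> S" using assms(2) by blast
  then obtain m where m: "m \<in> S" "\<And>y. (y, m) \<in> r - Id \<Longrightarrow> y \<notin> S"
    by (rule wfE_min[OF wf]) simp
  have "(m, x) \<in> r" if x: "x \<in> S" for x
    using not_lt[of x m] m(1) m(2)[of x] x assms(1) by (auto simp: underS_iff)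
  thus ?thesis using m(1) by blast
qed

text \<open>\<open>adm\<close> says that \<open>P f x\<close> looks only at the values of
  \<open>f\<close> strictly below \<open>x\<close>. Off \<open>Field r\<close> the condition is made
  vacuous, since the recursion runs over the whole type.\<close>

lemma choice_along:
  assumes P: "\<And>x f. x \<in> Field r \<Longrightarrow> (\<And>y. y \<in> underS r x \<Longrightarrow> P f y (f y)) \<Longrightarrow> \<exists>v. P f x v"
    and adm: "\<And>f g x v. (\<And>y. y \<in> underS r x \<Longrightarrow> f y = g y) \<Longrightarrow> P f x v = P g x v"
  shows "\<exists>f. \<forall>x\<in>Field r. P f x (f x)"
proof -
  have "\<exists>f. \<forall>x. x \<in> Field r \<longrightarrow> P f x (f x)"
  proof (rule dependent_wf_choice[OF wf])
    show "(x \<in> Field r \<longrightarrow> P f x v) = (x \<in> Field r \<longrightarrow> P g x v)"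
      if "\<And>z. (z, x) \<in> r - Id \<Longrightarrow> f z = g z" for f g x v
      using adm[of x f g v] that by (auto simp: underS_iff)
    show "\<exists>v. x \<in> Field r \<longrightarrow> P f x v"
      if "\<And>y. (y, x) \<in> r - Id \<Longrightarrow> y \<in> Field r \<longrightarrow> P f y (f y)" for f x
      using P[of x f] that by (auto simp: underS_iff underS_FieldI Field_def)
  qed
  thus ?thesis by blast
qed

end

lemma regular_cardinal_bounded:
  assumes reg: "regular_cardinal s" and T: "T \<subseteq> Field s" "|T| <o s"
  shows "\<exists>z\<in>Field s. \<forall>w\<in>T. w \<in> underS s z"
proof -
  interpret s: well_ordered s
    by standard (use reg in \<open>auto simp: regular_cardinal_def card_order_on_def\<close>)
  have "\<not> cofinal T s"
    using reg T not_ordLess_ordIso unfolding regular_cardinal_def regularCard_def by blast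
  then obtain z where z: "z \<in> Field s" "\<forall>w\<in>T. z \<notin> underS s w"
    unfolding cofinal_def underS_iff by blast
  hence le: "\<forall>w\<in>T. (w, z) \<in> s"
    using s.not_lt[OF z(1)] T(1) by blast
  have "\<not> finite (Field s)" "Card_order s"
    using reg by (auto simp: regular_cardinal_def cinfinite_def)
  \<comment> \<open>Failure of cofinality bounds \<open>T\<close> only weakly; an infinite cardinal
    has no largest element, so the bound can be made strict.\<close>
  then obtain z' where "z' \<in> Field s" "z \<in> underS s z'"
    using infinite_Card_order_limit[of s z] z(1) by (auto simp: underS_iff)
  thus ?thesis using le s.le_lt_trans by blast
qed

context well_ordered
begin

lemma Field_initial_ordinal: "Field (initial_ordinal r x) = underS r x"
  unfolding initial_ordinal_def
  by (rule Refl_Field_Restr2) (use refl underS_subset_Field[of r x] in \<open>auto simp: refl_on_def\<close>)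

lemma initial_ordinal_iff:
  "(y, z) \<in> initial_ordinal r x \<longleftrightarrow> (y, z) \<in> r \<and> y \<in> underS r x \<and> z \<in> underS r x"
  by (auto simp: initial_ordinal_def)

lemma card_of_underS_regular:
  assumes "regular_cardinal (initial_ordinal r x)"
  shows "|underS r x| =o initial_ordinal r x"
  using assms card_of_Field_ordIso[of "initial_ordinal r x"]
  by (simp add: regular_cardinal_def Field_initial_ordinal)

lemma underS_initial_ordinal:
  "y \<in> underS r x \<Longrightarrow> underS (initial_ordinal r x) y = underS r y"
  using lt_trans[of _ y x] by (auto simp: underS_iff[of _ "initial_ordinal r x"] underS_iff[of _ r y] initial_ordinal_iff)

lemma card_of_underS_less:
  assumes reg: "regular_cardinal (initial_ordinal r x)" and y: "y \<in> underS r x"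
  shows "|underS r y| <o |underS r x|"
proof -
  have "|underS (initial_ordinal r x) y| <o initial_ordinal r x"
    using reg y by (intro card_of_underS) (simp_all add: regular_cardinal_def Field_initial_ordinal)
  thus ?thesis
    using underS_initial_ordinal[OF y] ordLess_ordIso_trans ordIso_symmetric[OF card_of_underS_regular[OF reg]]
    by metis
qed

lemma regular_bounded:
  assumes reg: "regular_cardinal (initial_ordinal r x)"
    and T: "T \<subseteq> underS r x" "|T| <o |underS r x|"
  shows "\<exists>z\<in>underS r x. \<forall>w\<in>T. w \<in> underS r z"
proof -
  have "|T| <o initial_ordinal r x"
    using T(2) card_of_underS_regular[OF reg] by (rule ordLess_ordIso_trans)
  thus ?thesis
    using regular_cardinal_bounded[OF reg, of T] T(1) underS_initial_ordinal
    unfolding Field_initial_ordinal by metis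
qed

text \<open>This rules out the first alternative of \<open>escape\<close> at \<open>x0\<close> and,
  in \<open>escape_L\<close>, at the members of \<open>A\<close> above \<open>x0\<close>.\<close>

lemma regular_not_covered:
  assumes "regular_cardinal (initial_ordinal r x)"
  shows "\<not> (\<exists>T\<subseteq>underS r x. |T| <o |underS r x| \<and> (\<forall>z\<in>underS r x. \<exists>w\<in>T. (z, w) \<in> r))"
proof (intro notI, elim exE conjE)
  fix T assume T: "T \<subseteq> underS r x" "|T| <o |underS r x|" "\<forall>z\<in>underS r x. \<exists>w\<in>T. (z, w) \<in> r"
  obtain z where z: "z \<in> underS r x" "\<forall>w\<in>T. w \<in> underS r z"
    using regular_bounded[OF assms T(1,2)] by (elim bexE)
  obtain w where w: "w \<in> T" "(z, w) \<in> r" using T(3) z(1) by (meson bspec)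
  have "w \<in> underS r z" using z(2) w(1) by (rule bspec)
  thus False using lt_not_le w(2) by simp
qed

end

text \<open>Pigeonhole: if all fibres were small, \<open>X\<close> would be a union of fewer than
  \<kappa> sets of size less than \<kappa>.\<close>

lemma regular_fibre:
  assumes reg: "regular_cardinal \<kappa>" and X: "|X| =o \<kappa>" and c: "|c ` X| <o \<kappa>"
  shows "\<exists>v. |{x\<in>X. c x = v}| =o \<kappa>"
proof (rule ccontr)
  assume neg: "\<not> ?thesis"
  have \<kappa>: "Card_order \<kappa>" "\<not> finite (Field \<kappa>)" "regularCard \<kappa>"
    using reg by (auto simp: regular_cardinal_def cinfinite_def)
  have "|{x\<in>X. c x = v}| <o \<kappa>" for v
  proof -
    have "|{x\<in>X. c x = v}| \<le>o \<kappa>"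
      by (rule ordLeq_ordIso_trans[OF _ X]) (simp add: card_of_mono1)
    thus ?thesis using neg ordLeq_iff_ordLess_or_ordIso by blast
  qed
  hence "|\<Union>v\<in>c ` X. {x\<in>X. c x = v}| <o \<kappa>"
    by (intro stable_UNION regularCard_stable \<kappa> c)
  moreover have "(\<Union>v\<in>c ` X. {x\<in>X. c x = v}) = X" by blast
  ultimately show False using X not_ordLess_ordIso by auto
qed

section \<open>Ultrafilters as filters\<close>

definition ultra :: "'c filter \<Rightarrow> bool" where
  "ultra F \<longleftrightarrow> F \<noteq> bot \<and> (\<forall>P. eventually P F \<or> eventually (\<lambda>x. \<not> P x) F)"

lemma ultra_not: "ultra F \<Longrightarrow> \<not> eventually P F \<longleftrightarrow> eventually (\<lambda>x. \<not> P x) F"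
  unfolding ultra_def trivial_limit_def
  using eventually_conj[of P F "\<lambda>x. \<not> P x"] by auto

lemma ultra_ex: "ultra F \<Longrightarrow> eventually P F \<Longrightarrow> \<exists>x. P x"
  unfolding ultra_def by (blast intro: eventually_happens')

text \<open>Membership in \<open>D\<close> or \<open>E\<close> becomes an \<open>eventually\<close>
  statement, so intersections of large sets are handled by \<open>eventually_elim\<close>.\<close>

definition set_filter :: "'c set \<Rightarrow> 'c set set \<Rightarrow> 'c filter" where
  "set_filter X U = Abs_filter (\<lambda>P. {x\<in>X. P x} \<in> U)"

lemma eventually_set_filter:
  assumes U: "ultrafilter_on X U"
  shows "eventually P (set_filter X U) \<longleftrightarrow> {x\<in>X. P x} \<in> U"
  unfolding set_filter_def
proof (rule eventually_Abs_filter, unfold_locales)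
  show "{x\<in>X. True} \<in> U" using U by (simp add: ultrafilter_on_def)
  show "{x\<in>X. P x \<and> Q x} \<in> U" if "{x\<in>X. P x} \<in> U" "{x\<in>X. Q x} \<in> U" for P Q
  proof -
    have "{x\<in>X. P x \<and> Q x} = {x\<in>X. P x} \<inter> {x\<in>X. Q x}" by blast
    thus ?thesis using ultrafilter_on_Int[OF U that] by simp
  qed
  show "{x\<in>X. Q x} \<in> U" if "\<forall>x. P x \<longrightarrow> Q x" "{x\<in>X. P x} \<in> U" for P Q
    by (rule ultrafilter_on_mono[OF U that(2)]) (use that(1) in blast)+
qed

lemma ultra_set_filter:
  assumes U: "ultrafilter_on X U"
  shows "ultra (set_filter X U)"
  unfolding ultra_def trivial_limit_def eventually_set_filter[OF U]
proof (intro conjI allI)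
  show "{x\<in>X. False} \<notin> U" using U by (simp add: ultrafilter_on_def)
  fix P
  have "X - {x\<in>X. P x} = {x\<in>X. \<not> P x}" by blast
  thus "{x\<in>X. P x} \<in> U \<or> {x\<in>X. \<not> P x} \<in> U"
    using ultrafilter_on_cases[OF U, of "{x\<in>X. P x}"] by auto
qed

section \<open>Sequences in the product\<close>

text \<open>\<open>complete_d\<close> is the form in which the completeness of \<open>D\<close>
  enters: as |A| \<le> cf \<lambda>, one condition for each member of \<open>A\<close> can be met
  simultaneously.\<close>

locale complete_ultra =
  fixes A :: "'a set" and d :: "'i filter"
  assumes ultra_d: "ultra d"
    and complete_d: "\<And>P. (\<And>\<xi>. \<xi> \<in> A \<Longrightarrow> eventually (P \<xi>) d) \<Longrightarrow> eventually (\<lambda>i. \<forall>\<xi>\<in>A. P \<xi> i) d"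
begin

text \<open>Otherwise each alternative fails on a large set, and by completeness all of them fail at
  once.\<close>

lemma d_ex:
  assumes "eventually (\<lambda>i. \<exists>\<xi>\<in>A. P \<xi> i) d"
  shows "\<exists>\<xi>\<in>A. eventually (P \<xi>) d"
proof (rule ccontr)
  assume "\<not> ?thesis"
  hence "eventually (\<lambda>i. \<forall>\<xi>\<in>A. \<not> P \<xi> i) d"
    using ultra_not[OF ultra_d] by (intro complete_d) blast
  with assms have "eventually (\<lambda>i. False) d" by eventually_elim blast
  thus False using ultra_ex[OF ultra_d] by blast
qed

text \<open>Completeness is applied to the |A| many questions whether \<xi> belongs to
  \<open>s i\<close>, not to the possible values of \<open>s\<close>.\<close>

lemma d_const:
  assumes "\<And>i. s i \<subseteq> A"
  shows "\<exists>S\<subseteq>A. eventually (\<lambda>i. s i = S) d"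
proof -
  define S where "S = {\<xi>\<in>A. eventually (\<lambda>i. \<xi> \<in> s i) d}"
  have "eventually (\<lambda>i. \<forall>\<xi>\<in>A. \<xi> \<in> s i \<longleftrightarrow> \<xi> \<in> S) d"
  proof (rule complete_d)
    fix \<xi> assume \<xi>: "\<xi> \<in> A"
    show "eventually (\<lambda>i. \<xi> \<in> s i \<longleftrightarrow> \<xi> \<in> S) d"
      using ultra_not[OF ultra_d, of "\<lambda>i. \<xi> \<in> s i"] \<xi> by (cases "\<xi> \<in> S") (auto simp: S_def)
  qed
  hence "eventually (\<lambda>i. s i = S) d"
    by eventually_elim (use assms in \<open>auto simp: S_def\<close>)
  moreover have "S \<subseteq> A" by (auto simp: S_def)
  ultimately show ?thesis by (intro exI[of _ S] conjI)
qed

end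

text \<open>
  The element \<open>x0\<close> stands for \<open>\<rho>\<close>.  The last assumption replaces decomposability: for an ordinal \<open>y\<close> of
  cofinality at least \<open>\<rho>\<close>, a function from the index set of \<open>d\<close> to \<open>y\<close> that is not bounded below \<open>y\<close>
  on any set of the ultrafilter.
\<close>

locale escaping = complete_ultra A d
  for l :: "'a rel" and x0 :: 'a and A :: "'a set" and d :: "'i filter" +
  assumes Co: "Card_order l" and inf: "\<not> finite (Field l)"
    and A_sub: "A \<subseteq> Field l" and A_cof: "cofinal A l"
    and x0: "x0 \<in> Field l" and reg0: "regular_cardinal (initial_ordinal l x0)"
    and Pow_A: "|Pow A| <o |underS l x0|"
    and escape: "\<And>y. y \<in> Field l \<Longrightarrow>
      (\<exists>T\<subseteq>underS l y. |T| <o |underS l x0| \<and> (\<forall>z\<in>underS l y. \<exists>w\<in>T. (z, w) \<in> l)) \<or>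
      (\<exists>t. (\<forall>i. t i \<in> underS l y) \<and> (\<forall>z\<in>underS l y. eventually (\<lambda>i. z \<in> underS l (t i)) d))"
begin

sublocale l: well_ordered l
  by standard (use Co in \<open>simp add: card_order_on_def\<close>)

abbreviation L :: "'a set rel" where "L \<equiv> cardSuc l"

lemma Card_L: "Card_order L" and inf_L: "\<not> finite (Field L)" and regular_L: "regular_cardinal L"
  using Co inf cardSuc_Card_order cardSuc_finite infinite_cardSuc_regularCard
  by (auto simp: regular_cardinal_def cinfinite_def)

sublocale L: well_ordered L
  by standard (use Card_L in \<open>simp add: card_order_on_def\<close>)

lemma card_less_L: "|X| <o L \<longleftrightarrow> |X| \<le>o l"
  by (rule cardSuc_ordLeq_ordLess[OF Co card_of_Card_order])

lemma above_in_A: "y \<in> Field l \<Longrightarrow> \<exists>x\<in>A. y \<in> underS l x"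
  using A_cof unfolding cofinal_def underS_iff by blast

text \<open>An injection \<open>h\<close> of \<gamma> into \<lambda> sorts the elements of \<gamma>:
  \<alpha> enters \<open>B \<xi>\<close> when \<open>h \<alpha>\<close> is below \<xi>. Cofinality
  of \<open>A\<close> puts every \<alpha> into some piece.\<close>

lemma pieces:
  "\<exists>B :: 'a set \<Rightarrow> 'a \<Rightarrow> 'a set set. \<forall>\<gamma>\<in>Field L.
     (\<forall>\<xi>\<in>A. |B \<gamma> \<xi>| \<le>o |underS l \<xi>| ) \<and> (\<Union>\<xi>\<in>A. B \<gamma> \<xi>) = underS L \<gamma>"
proof -
  have "\<exists>B :: 'a \<Rightarrow> 'a set set. (\<forall>\<xi>\<in>A. |B \<xi>| \<le>o |underS l \<xi>| ) \<and> (\<Union>\<xi>\<in>A. B \<xi>) = underS L \<gamma>"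
    if \<gamma>: "\<gamma> \<in> Field L" for \<gamma>
  proof -
    have "|underS L \<gamma>| \<le>o |Field l|"
      using card_less_L card_of_underS[OF Card_L \<gamma>] ordLeq_ordIso_trans
        ordIso_symmetric[OF card_of_Field_ordIso[OF Co]] by blast
    then obtain h where h: "inj_on h (underS L \<gamma>)" "h ` underS L \<gamma> \<subseteq> Field l"
      using card_of_ordLeq[of "underS L \<gamma>" "Field l"] by blast
    define B where "B \<xi> = {\<alpha>\<in>underS L \<gamma>. h \<alpha> \<in> underS l \<xi>}" for \<xi>
    have "|B \<xi>| \<le>o |underS l \<xi>|" for \<xi>
      by (rule card_of_ordLeqI[of h]) (use h in \<open>auto simp: B_def inj_on_def\<close>)
    moreover have "(\<Union>\<xi>\<in>A. B \<xi>) = underS L \<gamma>"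
      using above_in_A h(2) by (fastforce simp: B_def)
    ultimately show ?thesis by blast
  qed
  thus ?thesis by metis
qed

end

section \<open>Products of regular cardinals modulo an ultrafilter\<close>

locale escaping_product = escaping l x0 A d
  for l :: "'a rel" and x0 A and d :: "'i filter" +
  fixes e :: "'a filter"
  assumes ultra_e: "ultra e" and e_A: "eventually (\<lambda>x. x \<in> A) e"
    and e_unbounded: "\<And>y. y \<in> Field l \<Longrightarrow> eventually (\<lambda>x. y \<in> underS l x) e"
    and regular: "\<And>x. x \<in> A \<Longrightarrow> regular_cardinal (initial_ordinal l x)"
begin

lemma underS_nonempty: "x \<in> A \<Longrightarrow> underS l x \<noteq> {}"
  using regular[of x] l.Field_initial_ordinal[of x]
  by (auto simp: regular_cardinal_def cinfinite_def)

text \<open>At a coordinate \<open>x\<close> above \<open>y\<close> the family is smaller than the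
  regular cardinal \<open>x\<close>, so its values are bounded there. The other coordinates are
  negligible for \<open>e\<close> and get any value. One set of \<open>e\<close> thus serves all
  \<open>s\<close>.\<close>

lemma small_family_bounded:
  assumes y: "y \<in> Field l" and S: "|S| \<le>o |underS l y|"
    and g: "\<And>s x. s \<in> S \<Longrightarrow> x \<in> A \<Longrightarrow> g s x \<in> underS l x"
  shows "\<exists>h. (\<forall>x\<in>A. h x \<in> underS l x) \<and> eventually (\<lambda>x. \<forall>s\<in>S. g s x \<in> underS l (h x)) e"
proof -
  have "\<exists>z. z \<in> underS l x \<and> (y \<in> underS l x \<longrightarrow> (\<forall>s\<in>S. g s x \<in> underS l z))" if x: "x \<in> A" for x
  proof (cases "y \<in> underS l x")
    case True
    have "|(\<lambda>s. g s x) ` S| <o |underS l x|"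
      using ordLeq_transitive[OF card_of_image S] l.card_of_underS_less[OF regular[OF x] True]
      by (rule ordLeq_ordLess_trans)
    moreover have "(\<lambda>s. g s x) ` S \<subseteq> underS l x" using g x by blast
    ultimately obtain z where "z \<in> underS l x" "\<forall>w\<in>(\<lambda>s. g s x) ` S. w \<in> underS l z"
      using l.regular_bounded[OF regular[OF x]] by blast
    thus ?thesis by (intro exI[of _ z]) simp
  next
    case False
    thus ?thesis using underS_nonempty[OF x] by blast
  qed
  then obtain h where h: "\<And>x. x \<in> A \<Longrightarrow> h x \<in> underS l x \<and> (y \<in> underS l x \<longrightarrow> (\<forall>s\<in>S. g s x \<in> underS l (h x)))"
    by metis
  have "eventually (\<lambda>x. \<forall>s\<in>S. g s x \<in> underS l (h x)) e"
    using e_unbounded[OF y] e_A by eventually_elim (simp add: h)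
  thus ?thesis using h by blast
qed

text \<open>\<open>bounded\<close> is the assumption to be refuted. At stage \<beta> each pair
  (\<gamma>, \<xi>) has a pointwise bound \<open>h \<gamma> \<xi>\<close>, and
  \<open>bounded\<close> puts one \<open>v\<close> above these at most
  \<open>\<lambda>\<^sup>+\<close> functions. The \<gamma> above \<beta> are included because
  \<open>colouring\<close> uses \<gamma> = \<open>t i\<close>.\<close>

lemma strong_sequence_exists:
  assumes bounded: "\<And>G. |G| \<le>o L \<Longrightarrow> \<forall>g\<in>G. \<forall>x\<in>A. g x \<in> underS l x \<Longrightarrow>
      \<exists>h. (\<forall>x\<in>A. h x \<in> underS l x) \<and> (\<forall>g\<in>G. eventually (\<lambda>x. g x \<in> underS l (h x)) e)"
    and B: "\<forall>\<gamma>\<in>Field L. \<forall>\<xi>\<in>A. |B \<gamma> \<xi>| \<le>o |underS l \<xi>|"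
  shows "\<exists>f. \<forall>\<beta>\<in>Field L. (\<forall>x\<in>A. f \<beta> x \<in> underS l x) \<and>
      (\<forall>\<gamma>\<in>Field L. \<forall>\<xi>\<in>A.
         eventually (\<lambda>x. \<forall>\<alpha>\<in>B \<gamma> \<xi> \<inter> underS L \<beta>. f \<alpha> x \<in> underS l (f \<beta> x)) e)"
proof (rule L.choice_along)
  fix \<beta> f
  assume f: "(\<forall>x\<in>A. f \<alpha> x \<in> underS l x) \<and>
      (\<forall>\<gamma>\<in>Field L. \<forall>\<xi>\<in>A.
         eventually (\<lambda>x. \<forall>\<delta>\<in>B \<gamma> \<xi> \<inter> underS L \<alpha>. f \<delta> x \<in> underS l (f \<alpha> x)) e)"
    if "\<alpha> \<in> underS L \<beta>" for \<alpha>
  define Q where "Q \<gamma> \<xi> h \<longleftrightarrow> (\<forall>x\<in>A. h x \<in> underS l x) \<and>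
      eventually (\<lambda>x. \<forall>\<alpha>\<in>B \<gamma> \<xi> \<inter> underS L \<beta>. f \<alpha> x \<in> underS l (h x)) e" for \<gamma> \<xi> h
  have "\<exists>h. Q \<gamma> \<xi> h" if "\<gamma> \<in> Field L" "\<xi> \<in> A" for \<gamma> \<xi>
    unfolding Q_def
  proof (rule small_family_bounded)
    show "\<xi> \<in> Field l" using that(2) A_sub by blast
    have "|B \<gamma> \<xi> \<inter> underS L \<beta>| \<le>o |B \<gamma> \<xi>|" by (simp add: card_of_mono1)
    moreover have "|B \<gamma> \<xi>| \<le>o |underS l \<xi>|" using B that by blast
    ultimately show "|B \<gamma> \<xi> \<inter> underS L \<beta>| \<le>o |underS l \<xi>|" by (rule ordLeq_transitive)
  qed (use f in blast)
  then obtain h where h: "\<And>\<gamma> \<xi>. \<gamma> \<in> Field L \<Longrightarrow> \<xi> \<in> A \<Longrightarrow> Q \<gamma> \<xi> (h \<gamma> \<xi>)"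
    by metis
  have "|A| \<le>o L"
  proof -
    have "|A| \<le>o l"
      using card_of_mono1[OF A_sub] card_of_Field_ordIso[OF Co] ordLeq_ordIso_trans by blast
    thus ?thesis using cardSuc_greater[OF Co] ordLeq_transitive ordLess_imp_ordLeq by blast
  qed
  hence "|Field L \<times> A| \<le>o L"
    using card_of_Times_ordLeq_infinite_Field[OF inf_L _ _ Card_L]
      card_of_Field_ordIso[OF Card_L] ordIso_imp_ordLeq by blast
  hence "|case_prod h ` (Field L \<times> A)| \<le>o L" using card_of_image ordLeq_transitive by blast
  moreover have "\<forall>g\<in>case_prod h ` (Field L \<times> A). \<forall>x\<in>A. g x \<in> underS l x"
    using h by (auto simp: Q_def)
  ultimately obtain v where v: "\<forall>x\<in>A. v x \<in> underS l x"
      "\<forall>g\<in>case_prod h ` (Field L \<times> A). eventually (\<lambda>x. g x \<in> underS l (v x)) e"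
    using bounded[of "case_prod h ` (Field L \<times> A)"] by blast
  have "eventually (\<lambda>x. \<forall>\<alpha>\<in>B \<gamma> \<xi> \<inter> underS L \<beta>. f \<alpha> x \<in> underS l (v x)) e"
    if \<gamma>: "\<gamma> \<in> Field L" and \<xi>: "\<xi> \<in> A" for \<gamma> \<xi>
  proof -
    have "eventually (\<lambda>x. h \<gamma> \<xi> x \<in> underS l (v x)) e" using v(2) \<gamma> \<xi> by auto
    with h[OF \<gamma> \<xi>, unfolded Q_def, THEN conjunct2] show ?thesis
    proof eventually_elim
      case (elim x)
      thus ?case using l.lt_trans[of _ "h \<gamma> \<xi> x" "v x"] by blast
    qed
  qed
  thus "\<exists>v. (\<forall>x\<in>A. v x \<in> underS l x) \<and>
      (\<forall>\<gamma>\<in>Field L. \<forall>\<xi>\<in>A.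
         eventually (\<lambda>x. \<forall>\<alpha>\<in>B \<gamma> \<xi> \<inter> underS L \<beta>. f \<alpha> x \<in> underS l (v x)) e)"
    using v(1) by blast
next
  fix f g :: "'a set \<Rightarrow> 'a \<Rightarrow> 'a" and \<beta> v
  assume "f \<alpha> = g \<alpha>" if "\<alpha> \<in> underS L \<beta>" for \<alpha>
  hence "(\<forall>\<alpha>\<in>B \<gamma> \<xi> \<inter> underS L \<beta>. f \<alpha> x \<in> underS l (v x)) =
      (\<forall>\<alpha>\<in>B \<gamma> \<xi> \<inter> underS L \<beta>. g \<alpha> x \<in> underS l (v x))" for \<gamma> \<xi> x
    by auto
  thus "((\<forall>x\<in>A. v x \<in> underS l x) \<and>
      (\<forall>\<gamma>\<in>Field L. \<forall>\<xi>\<in>A.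
         eventually (\<lambda>x. \<forall>\<alpha>\<in>B \<gamma> \<xi> \<inter> underS L \<beta>. f \<alpha> x \<in> underS l (v x)) e)) =
      ((\<forall>x\<in>A. v x \<in> underS l x) \<and>
      (\<forall>\<gamma>\<in>Field L. \<forall>\<xi>\<in>A.
         eventually (\<lambda>x. \<forall>\<alpha>\<in>B \<gamma> \<xi> \<inter> underS L \<beta>. g \<alpha> x \<in> underS l (v x)) e))"
    by simp
qed

end

section \<open>The strong sequence and its upper bounds\<close>

locale strong_sequence = escaping_product l x0 A d e
  for l :: "'a rel" and x0 A and d :: "'i filter" and e +
  fixes B :: "'a set \<Rightarrow> 'a \<Rightarrow> 'a set set" and f :: "'a set \<Rightarrow> 'a \<Rightarrow> 'a"
  assumes B_union: "\<And>\<gamma>. \<gamma> \<in> Field L \<Longrightarrow> (\<Union>\<xi>\<in>A. B \<gamma> \<xi>) = underS L \<gamma>"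
    and f_in: "\<And>\<beta> x. \<beta> \<in> Field L \<Longrightarrow> x \<in> A \<Longrightarrow> f \<beta> x \<in> underS l x"
    and f_strong: "\<And>\<beta> \<gamma> \<xi>. \<beta> \<in> Field L \<Longrightarrow> \<gamma> \<in> Field L \<Longrightarrow> \<xi> \<in> A \<Longrightarrow>
      eventually (\<lambda>x. \<forall>\<alpha>\<in>B \<gamma> \<xi> \<inter> underS L \<beta>. f \<alpha> x \<in> underS l (f \<beta> x)) e"
begin

lemma f_Field: "\<beta> \<in> Field L \<Longrightarrow> x \<in> A \<Longrightarrow> f \<beta> x \<in> Field l"
  by (rule underS_FieldI[OF f_in])

lemma f_less:
  assumes "\<alpha> \<in> underS L \<beta>"
  shows "eventually (\<lambda>x. f \<alpha> x \<in> underS l (f \<beta> x)) e"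
proof -
  have \<beta>: "\<beta> \<in> Field L" using assms by (rule underS_FieldI2)
  \<comment> \<open>Taking \<gamma> = \<beta> suffices: the pieces of \<beta> cover everything below
    it.\<close>
  then obtain \<xi> where \<xi>: "\<xi> \<in> A" "\<alpha> \<in> B \<beta> \<xi>" using B_union assms by blast
  from f_strong[OF \<beta> \<beta> \<xi>(1)] show ?thesis
    by eventually_elim (use \<xi> assms in blast)
qed

lemma f_le:
  assumes "(\<alpha>, \<beta>) \<in> L"
  shows "eventually (\<lambda>x. (f \<alpha> x, f \<beta> x) \<in> l) e"
proof (cases "\<alpha> = \<beta>")
  case True
  have "\<beta> \<in> Field L" using assms by (auto simp: Field_def)
  from e_A show ?thesis
    by eventually_elim (use True l.refl f_Field[OF \<open>\<beta> \<in> Field L\<close>] in blast)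
next
  case False
  hence "\<alpha> \<in> underS L \<beta>" using assms by (simp add: underS_iff)
  from f_less[OF this] show ?thesis by eventually_elim (rule l.lt_imp_le)
qed

text \<open>Choose \<open>\<xi> \<alpha>\<close> with \<alpha> in
  \<open>B (t i) (\<xi> \<alpha>)\<close> for most \<open>i\<close>, and let
  \<open>S \<beta>\<close> be the value on a large set of the set \<open>s \<beta> i\<close> of
  coordinates where \<open>f \<beta>\<close> exceeds the earlier functions from
  \<open>B (t i) (\<xi> \<beta>)\<close>. The colour is the pair (\<open>\<xi> \<beta>\<close>,
  \<open>S \<beta>\<close>). For \<alpha> < \<beta> with equal first components a single
  \<open>i\<close> realises both choices, so \<open>f \<alpha>\<close> is below
  \<open>f \<beta>\<close> on all of \<open>S \<beta>\<close>.\<close>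

lemma colouring:
  assumes X: "X \<subseteq> Field L" and t: "\<And>\<alpha>. \<alpha> \<in> X \<Longrightarrow> eventually (\<lambda>i. \<alpha> \<in> underS L (t i)) d"
  shows "\<exists>c. \<forall>\<beta>\<in>X. c \<beta> \<in> A \<times> Pow A \<and> eventually (\<lambda>x. x \<in> snd (c \<beta>)) e \<and>
    (\<forall>\<alpha>\<in>X \<inter> underS L \<beta>. fst (c \<alpha>) = fst (c \<beta>) \<longrightarrow>
      (\<forall>x\<in>snd (c \<beta>). f \<alpha> x \<in> underS l (f \<beta> x)))"
proof -
  have "\<exists>\<xi>\<in>A. eventually (\<lambda>i. \<alpha> \<in> B (t i) \<xi>) d" if "\<alpha> \<in> X" for \<alpha>
  proof (rule d_ex)
    from t[OF that] show "eventually (\<lambda>i. \<exists>\<xi>\<in>A. \<alpha> \<in> B (t i) \<xi>) d"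
    proof eventually_elim
      case (elim i)
      thus ?case using B_union[OF underS_FieldI2[OF elim]] by blast
    qed
  qed
  then obtain \<xi> where \<xi>: "\<And>\<alpha>. \<alpha> \<in> X \<Longrightarrow> \<xi> \<alpha> \<in> A"
      "\<And>\<alpha>. \<alpha> \<in> X \<Longrightarrow> eventually (\<lambda>i. \<alpha> \<in> B (t i) (\<xi> \<alpha>)) d" by metis
  define s where "s \<beta> i = {x\<in>A. \<forall>\<alpha>\<in>B (t i) (\<xi> \<beta>) \<inter> underS L \<beta>. f \<alpha> x \<in> underS l (f \<beta> x)}" for \<beta> i
  have "\<exists>S\<subseteq>A. eventually (\<lambda>i. s \<beta> i = S) d" for \<beta>
    by (rule d_const) (simp add: s_def)
  then obtain S where S: "\<And>\<beta>. S \<beta> \<subseteq> A" "\<And>\<beta>. eventually (\<lambda>i. s \<beta> i = S \<beta>) d" by metis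
  have large: "eventually (\<lambda>x. x \<in> S \<beta>) e" if \<beta>: "\<beta> \<in> X" for \<beta>
  proof -
    obtain i where i: "s \<beta> i = S \<beta>" "\<beta> \<in> underS L (t i)"
      using ultra_ex[OF ultra_d eventually_conj[OF S(2)[of \<beta>] t[OF \<beta>]]] by blast
    have "\<beta> \<in> Field L" using X \<beta> by blast
    from f_strong[OF this underS_FieldI2[OF i(2)] \<xi>(1)[OF \<beta>]] e_A show ?thesis
      by eventually_elim (simp add: i(1)[symmetric] s_def)
  qed
  have mono: "f \<alpha> x \<in> underS l (f \<beta> x)"
    if ab: "\<alpha> \<in> X" "\<beta> \<in> X" "\<alpha> \<in> underS L \<beta>" "\<xi> \<alpha> = \<xi> \<beta>" "x \<in> S \<beta>" for \<alpha> \<beta> x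
  proof -
    obtain i where i: "s \<beta> i = S \<beta>" "\<alpha> \<in> B (t i) (\<xi> \<alpha>)"
      using ultra_ex[OF ultra_d eventually_conj[OF S(2)[of \<beta>] \<xi>(2)[OF ab(1)]]] by blast
    have "x \<in> s \<beta> i" using i(1) ab(5) by simp
    thus ?thesis unfolding s_def using i(2) ab(3,4) by simp
  qed
  show ?thesis
    by (rule exI[of _ "\<lambda>\<beta>. (\<xi> \<beta>, S \<beta>)"]) (use \<xi>(1) S(1) large mono in auto)
qed

lemma stable0: "stable (initial_ordinal l x0)"
  using reg0 by (intro regularCard_stable) (auto simp: regular_cardinal_def cinfinite_def)

lemma less0_iff: "|Y| <o initial_ordinal l x0 \<longleftrightarrow> |Y| <o |underS l x0|"
  using l.card_of_underS_regular[OF reg0] ordLess_ordIso_trans ordIso_symmetric by blast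

lemma card_A_less: "|A| <o |underS l x0|"
  using card_of_Pow Pow_A by (rule ordLess_transitive)

lemma card_colours: "|A \<times> Pow A| <o |underS l x0|"
  using stable_elim[OF stable0, of A "\<lambda>_. Pow A"] card_A_less Pow_A by (simp add: less0_iff)

lemma underS_less_l: "x \<in> Field l \<Longrightarrow> |underS l x| <o l"
  by (rule card_of_underS[OF Co])

lemma less_l_less_L: "|X| <o l \<Longrightarrow> |X| <o L"
  using cardSuc_greater[OF Co] by (rule ordLess_transitive[rotated])

text \<open>Fewer than \<lambda> colours leave \<open>\<lambda>\<^sup>+\<close> many indices of one
  colour. At a coordinate \<open>x\<close> of the common set their functions are strictly
  increasing, which injects \<open>\<lambda>\<^sup>+\<close> into the ordinal
  \<open>x\<close>.\<close>

lemma no_escape_L: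
  "\<not> (\<forall>\<alpha>\<in>Field L. eventually (\<lambda>i. \<alpha> \<in> underS L (t i)) d)"
proof
  assume t: "\<forall>\<alpha>\<in>Field L. eventually (\<lambda>i. \<alpha> \<in> underS L (t i)) d"
  obtain c where c: "\<And>\<beta>. \<beta> \<in> Field L \<Longrightarrow> c \<beta> \<in> A \<times> Pow A"
      "\<And>\<beta>. \<beta> \<in> Field L \<Longrightarrow> eventually (\<lambda>x. x \<in> snd (c \<beta>)) e"
      "\<And>\<alpha> \<beta> x. \<beta> \<in> Field L \<Longrightarrow> \<alpha> \<in> underS L \<beta> \<Longrightarrow> fst (c \<alpha>) = fst (c \<beta>) \<Longrightarrow>
        x \<in> snd (c \<beta>) \<Longrightarrow> f \<alpha> x \<in> underS l (f \<beta> x)"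
    using colouring[of "Field L" t] t underS_FieldI by (metis IntI subset_refl)
  have "|c ` Field L| \<le>o |A \<times> Pow A|" using c(1) by (intro card_of_mono1) blast
  hence "|c ` Field L| <o L"
    by (rule ordLeq_ordLess_trans)
      (rule less_l_less_L[OF ordLess_transitive[OF card_colours underS_less_l[OF x0]]])
  then obtain v where v: "|{\<beta>\<in>Field L. c \<beta> = v}| =o L"
    using regular_fibre[OF regular_L card_of_Field_ordIso[OF Card_L]] by blast
  let ?V = "{\<beta>\<in>Field L. c \<beta> = v}"
  have "?V \<noteq> {}"
  proof
    assume V: "?V = {}"
    have "|{} :: 'a set set| =o L" using v unfolding V .
    thus False using inf_L card_of_ordIso_finite_Field[OF Card_L] ordIso_symmetric by blast
  qed
  then obtain \<beta> where \<beta>: "\<beta> \<in> ?V" by blast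
  obtain x where x: "x \<in> snd v" "x \<in> A"
    using ultra_ex[OF ultra_e eventually_conj[OF c(2)[of \<beta>] e_A]] \<beta> by blast
  have "inj_on (\<lambda>\<alpha>. f \<alpha> x) ?V"
  proof (rule inj_onI, rule ccontr)
    fix \<alpha> \<beta> assume ab: "\<alpha> \<in> ?V" "\<beta> \<in> ?V" "f \<alpha> x = f \<beta> x" "\<alpha> \<noteq> \<beta>"
    hence "\<alpha> \<in> underS L \<beta> \<or> \<beta> \<in> underS L \<alpha>" using L.total by (auto simp: underS_iff)
    thus False using c(3)[of \<beta> \<alpha> x] c(3)[of \<alpha> \<beta> x] ab x(1) by (auto simp: underS_iff)
  qed
  hence "|?V| \<le>o |underS l x|"
    using f_in[OF _ x(2)] by (intro card_of_ordLeqI) auto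
  hence "|?V| <o L"
    using less_l_less_L[OF underS_less_l] x(2) A_sub ordLeq_ordLess_trans by blast
  thus False using v not_ordLess_ordIso by blast
qed

text \<open>A bound need not belong to the product: its values range over all of \<lambda>, at
  coordinates outside \<open>A\<close> as well.\<close>

abbreviation upper_bound :: "('a \<Rightarrow> 'a) \<Rightarrow> bool" where
  "upper_bound k \<equiv> (\<forall>x. k x \<in> Field l) \<and> (\<forall>\<alpha>\<in>Field L. eventually (\<lambda>x. (f \<alpha> x, k x) \<in> l) e)"

text \<open>
  If no least upper approximation of an \<open>f \<alpha>\<close> in \<open>T\<close> were an upper bound of the whole sequence, then
  \<open>\<rho>\<close> many of them would interleave with a subsequence of \<open>f\<close>; being pointwise increasing on a common set
  in \<open>e\<close>, they would inject \<open>\<rho>\<close> into some \<open>T x\<close>.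
\<close>

lemma projection:
  assumes T: "\<And>x. T x \<subseteq> Field l" and T_small: "\<And>x. |T x| <o |underS l x0|"
    and dom: "\<And>\<alpha>. \<alpha> \<in> Field L \<Longrightarrow> eventually (\<lambda>x. \<exists>y\<in>T x. (f \<alpha> x, y) \<in> l) e"
  shows "\<exists>k. upper_bound k \<and> eventually (\<lambda>x. k x \<in> T x) e \<and>
    (\<exists>\<alpha>\<in>Field L. eventually (\<lambda>x. \<forall>y\<in>T x. (f \<alpha> x, y) \<in> l \<longrightarrow> (k x, y) \<in> l) e)"
proof -
  define p where "p \<alpha> x y \<longleftrightarrow> y \<in> T x \<and> (f \<alpha> x, y) \<in> l \<and> (\<forall>z\<in>T x. (f \<alpha> x, z) \<in> l \<longrightarrow> (y, z) \<in> l)"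
    for \<alpha> x y
  \<comment> \<open>\<open>k \<alpha> x\<close> is the least element of \<open>T x\<close> from
    \<open>f \<alpha> x\<close> on; the default \<open>x0\<close> only keeps the value in
    \<open>Field l\<close>.\<close>
  define k where "k \<alpha> x = (if \<exists>y. p \<alpha> x y then SOME y. p \<alpha> x y else x0)" for \<alpha> x
  have k_p: "eventually (\<lambda>x. p \<alpha> x (k \<alpha> x)) e" if "\<alpha> \<in> Field L" for \<alpha>
    using dom[OF that]
  proof eventually_elim
    case (elim x)
    have "\<exists>y\<in>{y\<in>T x. (f \<alpha> x, y) \<in> l}. \<forall>z\<in>{y\<in>T x. (f \<alpha> x, y) \<in> l}. (y, z) \<in> l"
      by (rule l.least_exists) (use T elim in auto)
    hence "\<exists>y. p \<alpha> x y" unfolding p_def by blast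
    thus ?case by (simp add: k_def someI_ex)
  qed
  have k_Field: "k \<alpha> x \<in> Field l" for \<alpha> x
  proof (cases "\<exists>y. p \<alpha> x y")
    case True
    hence "p \<alpha> x (k \<alpha> x)" by (simp add: k_def someI_ex)
    thus ?thesis using T by (auto simp: p_def)
  qed (simp add: k_def x0)
  have "\<exists>\<alpha>\<in>Field L. upper_bound (k \<alpha>)"
  proof (rule ccontr)
    assume neg: "\<not> ?thesis"
    \<comment> \<open>Modulo an ultrafilter, a \<open>k \<alpha>\<close> that is no upper bound is
      overtaken by some \<open>f \<beta>\<close>; this \<beta> becomes
      \<open>n \<alpha>\<close>.\<close>
    have "\<exists>\<beta>\<in>Field L. eventually (\<lambda>x. k \<alpha> x \<in> underS l (f \<beta> x)) e" if "\<alpha> \<in> Field L" for \<alpha>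
    proof -
      have "\<exists>\<beta>\<in>Field L. \<not> eventually (\<lambda>x. (f \<beta> x, k \<alpha> x) \<in> l) e"
        using neg that k_Field by simp
      then obtain \<beta> where \<beta>: "\<beta> \<in> Field L" "\<not> eventually (\<lambda>x. (f \<beta> x, k \<alpha> x) \<in> l) e"
        by blast
      from \<beta>(2) have "eventually (\<lambda>x. (f \<beta> x, k \<alpha> x) \<notin> l) e" by (simp add: ultra_not[OF ultra_e])
      hence "eventually (\<lambda>x. k \<alpha> x \<in> underS l (f \<beta> x)) e" using e_A
        by eventually_elim (simp add: l.not_lt[OF k_Field f_Field[OF \<beta>(1)], symmetric])
      thus ?thesis using \<beta>(1) by blast
    qed
    then obtain n where n: "\<And>\<alpha>. \<alpha> \<in> Field L \<Longrightarrow> n \<alpha> \<in> Field L"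
        "\<And>\<alpha>. \<alpha> \<in> Field L \<Longrightarrow> eventually (\<lambda>x. k \<alpha> x \<in> underS l (f (n \<alpha>) x)) e" by metis
    \<comment> \<open>Thin out the sequence so that each chosen index lies beyond \<open>n\<close>
      of all earlier ones. The recursion has length \<lambda>, but only the terms before
      \<open>x0\<close> are used, with \<open>\<xi> x0\<close> as a bound for them.\<close>
    have "\<exists>g. \<forall>j\<in>Field l. g j \<in> Field L \<and> (\<forall>i\<in>underS l j. g i \<in> underS L (g j) \<and> n (g i) \<in> underS L (g j))"
    proof (rule l.choice_along)
      fix j g
      assume j: "j \<in> Field l"
      assume g: "g i \<in> Field L \<and> (\<forall>i'\<in>underS l i. g i' \<in> underS L (g i) \<and> n (g i') \<in> underS L (g i))"
          if "i \<in> underS l j" for i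
      let ?S = "g ` underS l j \<union> (\<lambda>i. n (g i)) ` underS l j"
      have "|underS l j| <o L" using less_l_less_L[OF underS_less_l[OF j]] .
      hence "|g ` underS l j| <o L" "|(\<lambda>i. n (g i)) ` underS l j| <o L"
        by (auto intro: ordLeq_ordLess_trans[OF card_of_image])
      hence "|?S| <o L"
        by (rule card_of_Un_ordLess_infinite_Field[OF inf_L Card_L])
      moreover have "?S \<subseteq> Field L" using g n(1) by blast
      ultimately obtain v where "v \<in> Field L" "\<forall>\<alpha>\<in>?S. \<alpha> \<in> underS L v"
        using regular_cardinal_bounded[OF regular_L, of ?S] by blast
      thus "\<exists>v. v \<in> Field L \<and> (\<forall>i\<in>underS l j. g i \<in> underS L v \<and> n (g i) \<in> underS L v)"
        by (intro exI[of _ v]) simp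
    qed simp
    then obtain \<xi> where \<xi>: "\<And>j. j \<in> Field l \<Longrightarrow> \<xi> j \<in> Field L"
        "\<And>i j. i \<in> underS l j \<Longrightarrow> \<xi> i \<in> underS L (\<xi> j)"
        "\<And>i j. i \<in> underS l j \<Longrightarrow> n (\<xi> i) \<in> underS L (\<xi> j)"
      by (metis underS_FieldI2)
    define R where "R = underS l x0"
    have R_Field: "R \<subseteq> Field l" unfolding R_def by (rule underS_subset_Field)
    have R_card: "|R| =o initial_ordinal l x0"
      unfolding R_def by (rule l.card_of_underS_regular[OF reg0])
    obtain c where c: "\<And>j. j \<in> R \<Longrightarrow> c (\<xi> j) \<in> A \<times> Pow A"
        "\<And>j. j \<in> R \<Longrightarrow> eventually (\<lambda>x. x \<in> snd (c (\<xi> j))) e"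
        "\<And>i j x. j \<in> R \<Longrightarrow> i \<in> R \<Longrightarrow> \<xi> i \<in> underS L (\<xi> j) \<Longrightarrow> fst (c (\<xi> i)) = fst (c (\<xi> j)) \<Longrightarrow>
          x \<in> snd (c (\<xi> j)) \<Longrightarrow> f (\<xi> i) x \<in> underS l (f (\<xi> j) x)"
    proof -
      have "\<exists>c. \<forall>\<beta>\<in>\<xi> ` R. c \<beta> \<in> A \<times> Pow A \<and> eventually (\<lambda>x. x \<in> snd (c \<beta>)) e \<and>
          (\<forall>\<alpha>\<in>\<xi> ` R \<inter> underS L \<beta>. fst (c \<alpha>) = fst (c \<beta>) \<longrightarrow>
            (\<forall>x\<in>snd (c \<beta>). f \<alpha> x \<in> underS l (f \<beta> x)))"
      \<comment> \<open>All indices from \<open>R\<close> lie below the fixed ordinal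
        \<open>\<xi> x0\<close>, so a constant function can serve as \<open>t\<close>.\<close>
      proof (rule colouring[where t = "\<lambda>_. \<xi> x0"])
        show "\<xi> ` R \<subseteq> Field L" using \<xi>(1) R_Field by blast
        show "eventually (\<lambda>i. \<alpha> \<in> underS L (\<xi> x0)) d" if "\<alpha> \<in> \<xi> ` R" for \<alpha>
          using that \<xi>(2) by (auto simp: R_def)
      qed
      thus thesis using that by blast
    qed
    have "(\<lambda>j. fst (c (\<xi> j))) ` R \<subseteq> A" using c(1) by force
    hence "|(\<lambda>j. fst (c (\<xi> j))) ` R| <o initial_ordinal l x0"
      using ordLeq_ordLess_trans[OF card_of_mono1 card_A_less] by (simp add: less0_iff)
    then obtain a where a: "|{j\<in>R. fst (c (\<xi> j)) = a}| =o initial_ordinal l x0"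
      using regular_fibre[OF reg0 R_card] by blast
    define R0 where "R0 = {j\<in>R. fst (c (\<xi> j)) = a}"
    have mono: "f (\<xi> i) x \<in> underS l (f (\<xi> j) x)"
      if "i \<in> R0" "j \<in> R0" "i \<in> underS l j" "x \<in> snd (c (\<xi> j))" for i j x
      using c(3)[of j i x] \<xi>(2)[OF that(3)] that by (simp add: R0_def)
    \<comment> \<open>\<open>R0\<close> has size \<rho> and is thus unbounded in \<rho>;
      \<open>m j\<close> will be the successor of \<open>j\<close> within \<open>R0\<close>.\<close>
    have "\<exists>m\<in>R0. j \<in> underS l m \<and> (\<forall>i\<in>R0. j \<in> underS l i \<longrightarrow> (m, i) \<in> l)" if j: "j \<in> R0" for j
    proof -
      have "\<exists>m\<in>R0. j \<in> underS l m"
      proof (rule ccontr)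
        assume neg: "\<not> ?thesis"
        have "R0 \<subseteq> underS l j \<union> {j}"
        proof
          fix i assume i: "i \<in> R0"
          hence "i \<in> Field l" "j \<in> Field l" using j R_Field by (auto simp: R0_def)
          hence "(i, j) \<in> l" using neg i l.not_lt[of j i] by blast
          thus "i \<in> underS l j \<union> {j}" by (auto simp: underS_iff)
        qed
        moreover have "|underS l j \<union> {j}| <o initial_ordinal l x0"
        proof (rule Un_singleton_ordLess)
          show "|underS l j| <o initial_ordinal l x0"
            using l.card_of_underS_less[OF reg0] j by (auto simp: R0_def R_def less0_iff)
        qed (use reg0 in \<open>auto simp: regular_cardinal_def cinfinite_def\<close>)
        ultimately have "|R0| <o initial_ordinal l x0" by (rule ordLeq_ordLess_trans[OF card_of_mono1])
        thus False using a not_ordLess_ordIso unfolding R0_def by blast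
      qed
      hence "\<exists>m\<in>{m\<in>R0. j \<in> underS l m}. \<forall>i\<in>{m\<in>R0. j \<in> underS l m}. (m, i) \<in> l"
        by (intro l.least_exists) (use R_Field in \<open>auto simp: R0_def\<close>)
      thus ?thesis by blast
    qed
    then obtain m where m: "\<And>j. j \<in> R0 \<Longrightarrow> m j \<in> R0" "\<And>j. j \<in> R0 \<Longrightarrow> j \<in> underS l (m j)"
        "\<And>i j. j \<in> R0 \<Longrightarrow> i \<in> R0 \<Longrightarrow> j \<in> underS l i \<Longrightarrow> (m j, i) \<in> l" by metis
    \<comment> \<open>Since \<open>n (\<xi> j)\<close> is below \<open>\<xi> (m j)\<close>, the
      overtaking has happened by \<open>f (\<xi> (m j))\<close>. As |Pow A| < \<rho>, many
      \<open>j\<close> share the same set \<open>s j\<close>.\<close>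
    define s where "s j = {x\<in>A. x \<in> snd (c (\<xi> j)) \<and> p (\<xi> j) x (k (\<xi> j) x) \<and>
        k (\<xi> j) x \<in> underS l (f (\<xi> (m j)) x)}" for j
    have s_large: "eventually (\<lambda>x. x \<in> s j) e" if j: "j \<in> R0" for j
    proof -
      have j': "j \<in> R" "\<xi> j \<in> Field L" using j \<xi>(1) R_Field by (auto simp: R0_def)
      from n(2)[OF j'(2)] f_less[OF \<xi>(3)[OF m(2)[OF j]]] k_p[OF j'(2)] c(2)[OF j'(1)] e_A
      show ?thesis
        by eventually_elim (simp add: s_def l.lt_trans)
    qed
    have "s ` R0 \<subseteq> Pow A" by (auto simp: s_def)
    hence "|s ` R0| <o initial_ordinal l x0"
      using ordLeq_ordLess_trans[OF card_of_mono1 Pow_A] by (simp add: less0_iff)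
    then obtain S where S: "|{j\<in>R0. s j = S}| =o initial_ordinal l x0"
      using regular_fibre[OF reg0 a[folded R0_def]] by blast
    let ?R1 = "{j\<in>R0. s j = S}"
    have "?R1 \<noteq> {}"
    proof
      assume R1: "?R1 = {}"
      have "|{} :: 'a set| =o initial_ordinal l x0" using S unfolding R1 .
      thus False using reg0 card_of_ordIso_finite_Field ordIso_symmetric
        by (auto simp: regular_cardinal_def cinfinite_def)
    qed
    then obtain j0 where "j0 \<in> ?R1" by blast
    then obtain x where x: "x \<in> S" using ultra_ex[OF ultra_e s_large[of j0]] by blast
    \<comment> \<open>The interleaving at \<open>x\<close> reads \<open>k (\<xi> i) x\<close> <
      \<open>f (\<xi> (m i)) x\<close> \<le> \<open>f (\<xi> j) x\<close> \<le>
      \<open>k (\<xi> j) x\<close>.\<close>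
    have inc: "k (\<xi> i) x \<in> underS l (k (\<xi> j) x)" if i: "i \<in> ?R1" and j: "j \<in> ?R1" and ij: "i \<in> underS l j" for i j
    proof -
      have xi: "x \<in> s i" and xj: "x \<in> s j" using i j x by auto
      have "(f (\<xi> (m i)) x, f (\<xi> j) x) \<in> l"
      proof (cases "m i = j")
        case True
        have "f (\<xi> j) x \<in> Field l" by (rule f_Field) (use xj j \<xi>(1) R_Field in \<open>auto simp: s_def R0_def\<close>)
        thus ?thesis using True l.refl by simp
      next
        case False
        have "m i \<in> underS l j" using False m(3)[of i j] i j ij by (simp add: underS_iff)
        moreover have "x \<in> snd (c (\<xi> j))" using xj by (simp add: s_def)
        ultimately have "f (\<xi> (m i)) x \<in> underS l (f (\<xi> j) x)"
          using mono[of "m i" j x] m(1)[of i] i j by blast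
        thus ?thesis by (rule l.lt_imp_le)
      qed
      moreover have "(f (\<xi> j) x, k (\<xi> j) x) \<in> l" using xj by (simp add: s_def p_def)
      ultimately have "(f (\<xi> (m i)) x, k (\<xi> j) x) \<in> l" by (rule l.le_trans)
      moreover have "k (\<xi> i) x \<in> underS l (f (\<xi> (m i)) x)" using xi by (simp add: s_def)
      ultimately show ?thesis using l.lt_le_trans[of _ _ "k (\<xi> j) x"] by simp
    qed
    have "inj_on (\<lambda>j. k (\<xi> j) x) ?R1"
    proof (rule inj_onI, rule ccontr)
      fix i j assume ij: "i \<in> ?R1" "j \<in> ?R1" "k (\<xi> i) x = k (\<xi> j) x" "i \<noteq> j"
      hence "i \<in> Field l" "j \<in> Field l" using R_Field by (auto simp: R0_def)
      hence "i \<in> underS l j \<or> j \<in> underS l i" using l.total ij(4) by (auto simp: underS_iff)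
      thus False using inc[OF ij(1,2)] inc[OF ij(2,1)] ij(3) by (auto simp: underS_iff)
    qed
    moreover have "k (\<xi> j) x \<in> T x" if "j \<in> ?R1" for j
    proof -
      have "x \<in> s j" using that x by simp
      thus ?thesis by (simp add: s_def p_def)
    qed
    ultimately have "|?R1| \<le>o |T x|" by (intro card_of_ordLeqI)
    hence "|?R1| <o initial_ordinal l x0"
      unfolding less0_iff using T_small by (rule ordLeq_ordLess_trans)
    thus False using S not_ordLess_ordIso by blast
  qed
  then obtain \<alpha> where \<alpha>: "\<alpha> \<in> Field L" "upper_bound (k \<alpha>)" by blast
  have "eventually (\<lambda>x. k \<alpha> x \<in> T x) e"
    using k_p[OF \<alpha>(1)] by eventually_elim (simp add: p_def)
  moreover have "eventually (\<lambda>x. \<forall>y\<in>T x. (f \<alpha> x, y) \<in> l \<longrightarrow> (k \<alpha> x, y) \<in> l) e"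
    using k_p[OF \<alpha>(1)] by eventually_elim (simp add: p_def)
  ultimately show ?thesis using \<alpha> by blast
qed

text \<open>If most \<open>k x\<close> have small cofinal sets, \<open>projection\<close> into these
  gives the new bound. Otherwise most \<open>k x\<close> admit an escaping function
  \<open>t x\<close>, giving candidates \<open>v i x = t x i\<close>. If each \<open>v i\<close>
  failed at some \<open>F i\<close>, then \<open>F\<close> would escape
  \<open>\<lambda>\<^sup>+\<close>: by completeness \<open>f \<alpha>\<close> is below
  \<open>v i\<close> for most \<open>i\<close>, so \<open>F i\<close> is beyond \<alpha>. This
  contradicts \<open>no_escape_L\<close>.\<close>

lemma smaller_upper_bound:
  assumes k: "upper_bound k"
  shows "\<exists>v. upper_bound v \<and> eventually (\<lambda>x. v x \<in> underS l (k x)) e"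
proof -
  define covered where "covered x T \<longleftrightarrow> T \<subseteq> underS l (k x) \<and> |T| <o |underS l x0| \<and>
      (\<forall>z\<in>underS l (k x). \<exists>w\<in>T. (z, w) \<in> l)" for x T
  define escaped where "escaped x t \<longleftrightarrow> (\<forall>i. t i \<in> underS l (k x)) \<and>
      (\<forall>z\<in>underS l (k x). eventually (\<lambda>i. z \<in> underS l (t i)) d)" for x and t :: "'i \<Rightarrow> 'a"
  have cases: "(\<exists>T. covered x T) \<or> (\<exists>t. escaped x t)" for x
    using escape[of "k x"] k unfolding covered_def escaped_def by blast
  have below: "eventually (\<lambda>x. f \<alpha> x \<in> underS l (k x)) e" if \<alpha>: "\<alpha> \<in> Field L" for \<alpha>
  proof -
    obtain \<beta> where \<beta>: "\<alpha> \<in> underS L \<beta>"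
      using infinite_Card_order_limit[OF Card_L inf_L \<alpha>] by (auto simp: underS_iff)
    have "eventually (\<lambda>x. (f \<beta> x, k x) \<in> l) e" using k underS_FieldI2[OF \<beta>] by blast
    with f_less[OF \<beta>] show ?thesis by eventually_elim (rule l.lt_le_trans)
  qed
  show ?thesis
  proof (cases "eventually (\<lambda>x. \<exists>T. covered x T) e")
    case True
    define T where "T x = (if \<exists>T. covered x T then SOME T. covered x T else {})" for x
    have T: "covered x (T x)" if "\<exists>T. covered x T" for x
      using that by (simp add: T_def someI_ex)
    have T': "T x = {}" if "\<nexists>T. covered x T" for x
      using that by (simp add: T_def)
    have sub: "T x \<subseteq> underS l (k x)" for x
      using T[of x] T'[of x] by (cases "\<exists>T. covered x T") (auto simp: covered_def)
    have "\<exists>v. upper_bound v \<and> eventually (\<lambda>x. v x \<in> T x) e \<and>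
        (\<exists>\<alpha>\<in>Field L. eventually (\<lambda>x. \<forall>y\<in>T x. (f \<alpha> x, y) \<in> l \<longrightarrow> (v x, y) \<in> l) e)"
    proof (rule projection)
      fix x
      show "T x \<subseteq> Field l" using sub[of x] underS_subset_Field[of l "k x"] by blast
      show "|T x| <o |underS l x0|"
      proof (cases "\<exists>T. covered x T")
        case True
        thus ?thesis using T by (simp add: covered_def)
      next
        case False
        have "|{} :: 'a set| \<le>o |A|" by (rule card_of_empty)
        thus ?thesis using T'[OF False] card_A_less by (simp add: ordLeq_ordLess_trans)
      qed
    next
      fix \<alpha> assume "\<alpha> \<in> Field L"
      from below[OF this] True show "eventually (\<lambda>x. \<exists>y\<in>T x. (f \<alpha> x, y) \<in> l) e"
      proof eventually_elim
        case (elim x)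
        thus ?case using T[OF elim(2)] unfolding covered_def by blast
      qed
    qed
    then obtain v where v: "upper_bound v" "eventually (\<lambda>x. v x \<in> T x) e" by blast
    from v(2) have "eventually (\<lambda>x. v x \<in> underS l (k x)) e"
      by eventually_elim (use sub in blast)
    thus ?thesis using v(1) by blast
  next
    case False
    hence ev: "eventually (\<lambda>x. \<exists>t. escaped x t) e"
      unfolding ultra_not[OF ultra_e] by eventually_elim (use cases in blast)
    define t where "t x = (SOME t. escaped x t)" for x
    define v where "v i x = (if \<exists>t. escaped x t then t x i else x0)" for i x
    have t: "escaped x (t x)" if "\<exists>t. escaped x t" for x
      using that unfolding t_def by (rule someI_ex)
    have v_t: "v i x \<in> underS l (k x)" if "\<exists>t. escaped x t" for i x
      using t[OF that] that by (simp add: v_def escaped_def)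
    have v_Field: "v i x \<in> Field l" for i x
      using v_t[of x i] x0 underS_FieldI by (cases "\<exists>t. escaped x t") (auto simp: v_def)
    have v_less: "eventually (\<lambda>x. v i x \<in> underS l (k x)) e" for i
      using ev by eventually_elim (rule v_t)
    have "\<exists>i. upper_bound (v i)"
    proof (rule ccontr)
      assume neg: "\<nexists>i. upper_bound (v i)"
      have "\<exists>\<alpha>\<in>Field L. \<not> eventually (\<lambda>x. (f \<alpha> x, v i x) \<in> l) e" for i
        using neg v_Field by simp
      then obtain F where F: "\<And>i. F i \<in> Field L" "\<And>i. \<not> eventually (\<lambda>x. (f (F i) x, v i x) \<in> l) e"
        by metis
      have "eventually (\<lambda>i. \<alpha> \<in> underS L (F i)) d" if \<alpha>: "\<alpha> \<in> Field L" for \<alpha>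
      proof -
        define good where "good x \<longleftrightarrow> (\<exists>t. escaped x t) \<and> f \<alpha> x \<in> underS l (k x)" for x
        have good: "eventually (\<lambda>x. good x) e"
          unfolding good_def by (rule eventually_conj[OF ev below[OF \<alpha>]])
        have "eventually (\<lambda>i. \<forall>x\<in>A. good x \<longrightarrow> f \<alpha> x \<in> underS l (v i x)) d"
        proof (rule complete_d)
          fix x assume "x \<in> A"
          show "eventually (\<lambda>i. good x \<longrightarrow> f \<alpha> x \<in> underS l (v i x)) d"
          proof (cases "good x")
            case True
            hence g: "\<exists>t. escaped x t" "f \<alpha> x \<in> underS l (k x)" by (simp_all add: good_def)
            have "eventually (\<lambda>i. f \<alpha> x \<in> underS l (t x i)) d"
              using t[OF g(1)] g(2) unfolding escaped_def by blast
            thus ?thesis by eventually_elim (simp add: v_def g(1))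
          qed simp
        qed
        thus ?thesis
        proof eventually_elim
          case (elim i)
          show ?case
          proof (rule ccontr)
            assume "\<alpha> \<notin> underS L (F i)"
            hence "(F i, \<alpha>) \<in> L" using L.not_lt \<alpha> F(1) by blast
            from f_le[OF this] good e_A have "eventually (\<lambda>x. (f (F i) x, v i x) \<in> l) e"
            proof eventually_elim
              case (elim x)
              thus ?case using \<open>\<forall>x\<in>A. good x \<longrightarrow> f \<alpha> x \<in> underS l (v i x)\<close>
                l.lt_imp_le[of "f \<alpha> x" "v i x"] l.le_trans[of "f (F i) x" "f \<alpha> x" "v i x"] by blast
            qed
            thus False using F(2) by blast
          qed
        qed
      qed
      thus False using no_escape_L[of F] by blast
    qed
    thus ?thesis using v_less by blast
  qed
qed

text \<open>Alternating \<open>projection\<close>, which goes weakly below all earlier bounds, with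
  \<open>smaller_upper_bound\<close> gives a strictly decreasing \<rho>-sequence modulo
  \<open>e\<close>. An escaping function into \<rho> turns it into a descent at a single
  coordinate.\<close>

lemma no_upper_bound: "\<not> upper_bound k"
proof
  assume k: "upper_bound k"
  \<comment> \<open>The recursion runs along \<lambda>; the guard makes it vacuous from
    \<open>x0\<close> on, where there would be too many earlier bounds for
    \<open>projection\<close>.\<close>
  define P where "P u j v \<longleftrightarrow> (j \<in> underS l x0 \<longrightarrow> upper_bound v \<and>
      (\<forall>i\<in>underS l j. eventually (\<lambda>x. v x \<in> underS l (u i x)) e))" for u :: "'a \<Rightarrow> 'a \<Rightarrow> 'a" and j v
  have "\<exists>u. \<forall>j\<in>Field l. P u j (u j)"
  proof (rule l.choice_along)
    fix j and u :: "'a \<Rightarrow> 'a \<Rightarrow> 'a"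
    assume "P u i (u i)" if "i \<in> underS l j" for i
    show "\<exists>v. P u j v"
    proof (cases "j \<in> underS l x0")
      case j: True
      have u: "upper_bound (u i)" if "i \<in> underS l j" for i
        using \<open>i \<in> underS l j \<Longrightarrow> P u i (u i)\<close>[OF that] l.lt_trans[OF that j] unfolding P_def by blast
      \<comment> \<open>The value \<open>k x\<close> guarantees domination, also at the first stage,
        when there are no earlier bounds.\<close>
      define T where "T x = (\<lambda>i. u i x) ` underS l j \<union> {k x}" for x
      have "\<exists>v. upper_bound v \<and> eventually (\<lambda>x. v x \<in> T x) e \<and>
        (\<exists>\<alpha>\<in>Field L. eventually (\<lambda>x. \<forall>y\<in>T x. (f \<alpha> x, y) \<in> l \<longrightarrow> (v x, y) \<in> l) e)"
      proof (rule projection)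
        fix x
        show "T x \<subseteq> Field l" unfolding T_def using u k by blast
        have "|T x| <o initial_ordinal l x0"
          unfolding T_def
        proof (rule Un_singleton_ordLess)
          show "|(\<lambda>i. u i x) ` underS l j| <o initial_ordinal l x0"
            unfolding less0_iff
            by (rule ordLeq_ordLess_trans[OF card_of_image l.card_of_underS_less[OF reg0 j]])
        qed (use reg0 in \<open>auto simp: regular_cardinal_def cinfinite_def\<close>)
        thus "|T x| <o |underS l x0|" by (simp add: less0_iff)
      next
        fix \<alpha> assume "\<alpha> \<in> Field L"
        hence "eventually (\<lambda>x. (f \<alpha> x, k x) \<in> l) e" using k by blast
        thus "eventually (\<lambda>x. \<exists>y\<in>T x. (f \<alpha> x, y) \<in> l) e"
          by eventually_elim (simp add: T_def)
      qed
      then obtain v \<alpha> where v: "upper_bound v" "\<alpha> \<in> Field L"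
          "eventually (\<lambda>x. \<forall>y\<in>T x. (f \<alpha> x, y) \<in> l \<longrightarrow> (v x, y) \<in> l) e" by blast
      obtain w where w: "upper_bound w" "eventually (\<lambda>x. w x \<in> underS l (v x)) e"
        using smaller_upper_bound[OF v(1)] by blast
      have "eventually (\<lambda>x. w x \<in> underS l (u i x)) e" if i: "i \<in> underS l j" for i
      proof -
        \<comment> \<open>\<open>v x\<close> lies below every member of \<open>T x\<close> that is
          at least \<open>f \<alpha> x\<close>, and \<open>u i x\<close> is such a member.\<close>
        have "eventually (\<lambda>x. (f \<alpha> x, u i x) \<in> l) e" using u[OF i] v(2) by blast
        with v(3) w(2) show ?thesis
        proof eventually_elim
          case (elim x)
          have "u i x \<in> T x" using i by (simp add: T_def)
          thus ?case using elim l.lt_le_trans[of "w x" "v x" "u i x"] by blast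
        qed
      qed
      thus ?thesis using w(1) unfolding P_def by blast
    qed (simp add: P_def)
  next
    fix u u' :: "'a \<Rightarrow> 'a \<Rightarrow> 'a" and j v
    assume "u i = u' i" if "i \<in> underS l j" for i
    thus "P u j v = P u' j v" unfolding P_def by simp
  qed
  then obtain u where uP: "\<And>j. j \<in> Field l \<Longrightarrow> P u j (u j)" by blast
  have u: "upper_bound (u j)" "\<forall>i\<in>underS l j. eventually (\<lambda>x. u j x \<in> underS l (u i x)) e"
    if j: "j \<in> underS l x0" for j
    using uP[OF underS_FieldI[OF j]] j unfolding P_def by simp_all
  have "\<exists>t. (\<forall>i. t i \<in> underS l x0) \<and> (\<forall>z\<in>underS l x0. eventually (\<lambda>i. z \<in> underS l (t i)) d)"
    by (rule disjE[OF escape[OF x0] notE[OF l.regular_not_covered[OF reg0]]])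
  then obtain t where t: "\<And>i. t i \<in> underS l x0" "\<And>z. z \<in> underS l x0 \<Longrightarrow> eventually (\<lambda>i. z \<in> underS l (t i)) d"
    by blast
  \<comment> \<open>By completeness the coordinate witnessing \<open>u (t i) < u j\<close> can be taken to be the same \<open>x\<close> for
    all \<open>j\<close> in a large set; a minimal value \<open>u j x\<close> over this set is a contradiction.\<close>
  have "\<exists>x\<in>A. eventually (\<lambda>i. u (t i) x \<in> underS l (u j x)) d" if j: "j \<in> underS l x0" for j
  proof (rule d_ex)
    from t(2)[OF j] show "eventually (\<lambda>i. \<exists>x\<in>A. u (t i) x \<in> underS l (u j x)) d"
    proof eventually_elim
      case (elim i)
      show ?case using ultra_ex[OF ultra_e eventually_conj[OF e_A u(2)[OF t(1), rule_format, OF elim]]] by blast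
    qed
  qed
  then obtain y where y: "\<And>j. j \<in> underS l x0 \<Longrightarrow> y j \<in> A"
      "\<And>j. j \<in> underS l x0 \<Longrightarrow> eventually (\<lambda>i. u (t i) (y j) \<in> underS l (u j (y j))) d" by metis
  have "\<exists>x\<in>A. eventually (\<lambda>i. y (t i) = x) d"
    by (rule d_ex) (simp add: y(1)[OF t(1)])
  then obtain x where x: "eventually (\<lambda>i. y (t i) = x) d" by blast
  let ?W = "{j\<in>underS l x0. y j = x}"
  obtain i where "y (t i) = x" using ultra_ex[OF ultra_d x] by blast
  hence "?W \<noteq> {}" using t(1) by blast
  hence "\<exists>m\<in>(\<lambda>j. u j x) ` ?W. \<forall>z\<in>(\<lambda>j. u j x) ` ?W. (m, z) \<in> l"
    by (intro l.least_exists) (use u(1) in auto)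
  then obtain j where j: "j \<in> ?W" "\<And>i. i \<in> ?W \<Longrightarrow> (u j x, u i x) \<in> l" by blast
  obtain i where i: "u (t i) (y j) \<in> underS l (u j (y j))" "y (t i) = x"
    using ultra_ex[OF ultra_d eventually_conj[OF y(2)[of j] x]] j(1) by blast
  thus False using j l.lt_not_le[of "u (t i) x" "u j x"] t(1)[of i] by simp
qed

end

section \<open>Bounded and cofinal families in the product\<close>

context escaping_product
begin

text \<open>Were all families of \<open>\<lambda>\<^sup>+\<close> functions bounded, a strong
  sequence would exist and its own range would be bounded, against
  \<open>no_upper_bound\<close>.\<close>

lemma unbounded_family:
  "\<exists>G. |G| \<le>o L \<and> (\<forall>g\<in>G. \<forall>x\<in>A. g x \<in> underS l x) \<and>
    (\<forall>h. (\<forall>x\<in>A. h x \<in> underS l x) \<longrightarrow> (\<exists>g\<in>G. \<not> eventually (\<lambda>x. g x \<in> underS l (h x)) e))"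
proof (rule ccontr)
  assume "\<not> ?thesis"
  hence bounded: "\<exists>h. (\<forall>x\<in>A. h x \<in> underS l x) \<and> (\<forall>g\<in>G. eventually (\<lambda>x. g x \<in> underS l (h x)) e)"
    if "|G| \<le>o L" "\<forall>g\<in>G. \<forall>x\<in>A. g x \<in> underS l x" for G
    using that by blast
  obtain B :: "'a set \<Rightarrow> 'a \<Rightarrow> 'a set set" where B: "\<forall>\<gamma>\<in>Field L. \<forall>\<xi>\<in>A. |B \<gamma> \<xi>| \<le>o |underS l \<xi>|"
      "\<And>\<gamma>. \<gamma> \<in> Field L \<Longrightarrow> (\<Union>\<xi>\<in>A. B \<gamma> \<xi>) = underS L \<gamma>"
    using pieces by metis
  have "\<exists>f. \<forall>\<beta>\<in>Field L. (\<forall>x\<in>A. f \<beta> x \<in> underS l x) \<and>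
      (\<forall>\<gamma>\<in>Field L. \<forall>\<xi>\<in>A.
         eventually (\<lambda>x. \<forall>\<alpha>\<in>B \<gamma> \<xi> \<inter> underS L \<beta>. f \<alpha> x \<in> underS l (f \<beta> x)) e)"
    by (rule strong_sequence_exists[OF bounded B(1)])
  then obtain f where f: "\<And>\<beta> x. \<beta> \<in> Field L \<Longrightarrow> x \<in> A \<Longrightarrow> f \<beta> x \<in> underS l x"
      "\<And>\<beta> \<gamma> \<xi>. \<beta> \<in> Field L \<Longrightarrow> \<gamma> \<in> Field L \<Longrightarrow> \<xi> \<in> A \<Longrightarrow>
        eventually (\<lambda>x. \<forall>\<alpha>\<in>B \<gamma> \<xi> \<inter> underS L \<beta>. f \<alpha> x \<in> underS l (f \<beta> x)) e"
    by blast
  interpret strong_sequence l x0 A d e B f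
    by unfold_locales (fact B(2) f)+
  have "|f ` Field L| \<le>o L"
    using card_of_image card_of_Field_ordIso[OF Card_L] by (rule ordLeq_ordIso_trans)
  hence "\<exists>h. (\<forall>x\<in>A. h x \<in> underS l x) \<and> (\<forall>g\<in>f ` Field L. eventually (\<lambda>x. g x \<in> underS l (h x)) e)"
    by (rule bounded) (simp add: f(1))
  then obtain h where h: "\<forall>x\<in>A. h x \<in> underS l x" "\<forall>\<alpha>\<in>Field L. eventually (\<lambda>x. f \<alpha> x \<in> underS l (h x)) e"
    by (auto simp only: ball_simps)
  define k where "k x = (if x \<in> A then h x else x0)" for x
  have "k x \<in> Field l" for x
    using h(1) x0 underS_FieldI[of "h x" l x] by (simp add: k_def)
  moreover have "eventually (\<lambda>x. (f \<alpha> x, k x) \<in> l) e" if "\<alpha> \<in> Field L" for \<alpha>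
    using h(2)[rule_format, OF that] e_A by eventually_elim (simp add: k_def l.lt_imp_le)
  ultimately show False using no_upper_bound[of k] by blast
qed

text \<open>An injection into \<lambda> splits \<open>G\<close> into |A| many pieces of size at most
  |\<xi>| with \<xi> in \<open>A\<close>. Each piece has a bound \<open>H \<xi>\<close>, and these
  few bounds are bounded in turn.\<close>

lemma family_bounded:
  assumes G: "|G| \<le>o l" and g: "\<And>g x. g \<in> G \<Longrightarrow> x \<in> A \<Longrightarrow> g x \<in> underS l x"
  shows "\<exists>h. (\<forall>x\<in>A. h x \<in> underS l x) \<and> (\<forall>g\<in>G. eventually (\<lambda>x. g x \<in> underS l (h x)) e)"
proof -
  have "|G| \<le>o |Field l|"
    using G ordIso_symmetric[OF card_of_Field_ordIso[OF Co]] by (rule ordLeq_ordIso_trans)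
  then obtain c where c: "inj_on c G" "c ` G \<subseteq> Field l"
    using card_of_ordLeq[of G "Field l"] by blast
  define Q where "Q \<xi> h \<longleftrightarrow> (\<forall>x\<in>A. h x \<in> underS l x) \<and>
      eventually (\<lambda>x. \<forall>g\<in>{g\<in>G. c g \<in> underS l \<xi>}. g x \<in> underS l (h x)) e" for \<xi> h
  have "\<exists>h. Q \<xi> h" if \<xi>: "\<xi> \<in> A" for \<xi>
    unfolding Q_def
  proof (rule small_family_bounded)
    show "\<xi> \<in> Field l" using \<xi> A_sub by blast
    show "|{g\<in>G. c g \<in> underS l \<xi>}| \<le>o |underS l \<xi>|"
      by (rule card_of_ordLeqI[of c]) (use c(1) in \<open>auto simp: inj_on_def\<close>)
  qed (simp add: g)
  then obtain H where H: "\<And>\<xi>. \<xi> \<in> A \<Longrightarrow> Q \<xi> (H \<xi>)" by metis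
  have "\<exists>h. (\<forall>x\<in>A. h x \<in> underS l x) \<and> eventually (\<lambda>x. \<forall>\<xi>\<in>A. H \<xi> x \<in> underS l (h x)) e"
  proof (rule small_family_bounded[OF x0])
    show "|A| \<le>o |underS l x0|"
      using ordLess_transitive[OF card_of_Pow Pow_A] by (rule ordLess_imp_ordLeq)
  qed (use H in \<open>simp add: Q_def\<close>)
  then obtain h where h: "\<forall>x\<in>A. h x \<in> underS l x" "eventually (\<lambda>x. \<forall>\<xi>\<in>A. H \<xi> x \<in> underS l (h x)) e"
    by blast
  have "eventually (\<lambda>x. g x \<in> underS l (h x)) e" if g: "g \<in> G" for g
  proof -
    obtain \<xi> where \<xi>: "\<xi> \<in> A" "c g \<in> underS l \<xi>" using above_in_A[of "c g"] c(2) g by blast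
    from H[OF \<xi>(1), unfolded Q_def, THEN conjunct2] h(2) show ?thesis
    proof eventually_elim
      case (elim x)
      have "g x \<in> underS l (H \<xi> x)" "H \<xi> x \<in> underS l (h x)" using elim \<xi> g by blast+
      thus ?case by (rule l.lt_trans)
    qed
  qed
  thus ?thesis using h(1) by blast
qed

text \<open>Modulo an ultrafilter an unbounded family is cofinal: a \<open>g\<close> that is not
  below \<open>h\<close> is above it.\<close>

lemma cofinal_family:
  "\<exists>G. |G| \<le>o L \<and> (\<forall>g\<in>G. \<forall>x\<in>A. g x \<in> underS l x) \<and>
    (\<forall>h. (\<forall>x\<in>A. h x \<in> underS l x) \<longrightarrow> (\<exists>g\<in>G. eventually (\<lambda>x. (h x, g x) \<in> l) e))"
proof -
  obtain G where G: "|G| \<le>o L" "\<forall>g\<in>G. \<forall>x\<in>A. g x \<in> underS l x"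
      "\<And>h. \<forall>x\<in>A. h x \<in> underS l x \<Longrightarrow> \<exists>g\<in>G. \<not> eventually (\<lambda>x. g x \<in> underS l (h x)) e"
    using unbounded_family by blast
  have "\<exists>g\<in>G. eventually (\<lambda>x. (h x, g x) \<in> l) e" if h: "\<forall>x\<in>A. h x \<in> underS l x" for h
  proof -
    obtain g where g: "g \<in> G" "eventually (\<lambda>x. g x \<notin> underS l (h x)) e"
      using G(3)[OF h] by (auto simp: ultra_not[OF ultra_e])
    from g(2) e_A have "eventually (\<lambda>x. (h x, g x) \<in> l) e"
    proof eventually_elim
      case (elim x)
      have "g x \<in> underS l x" "h x \<in> underS l x" using G(2) g(1) h elim(2) by blast+
      thus ?case using l.not_lt[of "g x" "h x"] elim(1) underS_FieldI[of _ l x] by simp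
    qed
    thus ?thesis using g(1) by blast
  qed
  thus ?thesis using G(1,2) by blast
qed

text \<open>The escaping functions \<open>t x\<close> define for each \<open>i\<close> a function on
  \<open>A\<close>, which lies below a member \<open>p i\<close> of the cofinal family. Enumerating
  this family along \<open>\<lambda>\<^sup>+\<close>, let \<open>F i\<close> be an index of
  \<open>p i\<close>. The members with index up to \<alpha> have a common bound \<open>h\<close>;
  for most \<open>i\<close> the functions \<open>t x i\<close> exceed \<open>h\<close>, so
  \<open>F i\<close> is beyond \<alpha>.\<close>

lemma escape_L:
  "\<exists>t. (\<forall>i. t i \<in> Field L) \<and> (\<forall>\<alpha>\<in>Field L. eventually (\<lambda>i. \<alpha> \<in> underS L (t i)) d)"
proof -
  obtain G where G: "|G| \<le>o L" "\<And>g x. g \<in> G \<Longrightarrow> x \<in> A \<Longrightarrow> g x \<in> underS l x"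
      "\<And>h. \<forall>x\<in>A. h x \<in> underS l x \<Longrightarrow> \<exists>g\<in>G. eventually (\<lambda>x. (h x, g x) \<in> l) e"
    using cofinal_family by blast
  \<comment> \<open>No escape is demanded at coordinates \<open>x\<close> that are not above
    \<open>x0\<close>; they form a negligible set for \<open>e\<close>.\<close>
  define tail where "tail x t \<longleftrightarrow> (\<forall>i. t i \<in> underS l x) \<and>
      (x0 \<in> underS l x \<longrightarrow> (\<forall>z\<in>underS l x. eventually (\<lambda>i. z \<in> underS l (t i)) d))" for x and t :: "'i \<Rightarrow> 'a"
  have "\<exists>t. tail x t" if x: "x \<in> A" for x
  proof (cases "x0 \<in> underS l x")
    case True
    note less = l.card_of_underS_less[OF regular[OF x] True]
    have "\<not> (\<exists>T\<subseteq>underS l x. |T| <o |underS l x0| \<and> (\<forall>z\<in>underS l x. \<exists>w\<in>T. (z, w) \<in> l))"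
    proof
      assume "\<exists>T\<subseteq>underS l x. |T| <o |underS l x0| \<and> (\<forall>z\<in>underS l x. \<exists>w\<in>T. (z, w) \<in> l)"
      then obtain T where T: "T \<subseteq> underS l x" "|T| <o |underS l x0|" "\<forall>z\<in>underS l x. \<exists>w\<in>T. (z, w) \<in> l"
        by (elim exE conjE)
      have "|T| <o |underS l x|" using T(2) less by (rule ordLess_transitive)
      thus False using l.regular_not_covered[OF regular[OF x]] T(1,3) by blast
    qed
    moreover have "x \<in> Field l" using x A_sub by blast
    ultimately show ?thesis using escape[of x] unfolding tail_def by blast
  next
    case False
    thus ?thesis using underS_nonempty[OF x] unfolding tail_def by auto
  qed
  then obtain t where t: "\<And>x. x \<in> A \<Longrightarrow> tail x (t x)" by metis
  have "\<exists>g\<in>G. eventually (\<lambda>x. (t x i, g x) \<in> l) e" for i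
    using G(3)[of "\<lambda>x. t x i"] t unfolding tail_def by blast
  then obtain p where p: "\<And>i. p i \<in> G" "\<And>i. eventually (\<lambda>x. (t x i, p i x) \<in> l) e" by metis
  have "G \<noteq> {}" using p(1) by blast
  moreover have "|G| \<le>o |Field L|"
    using G(1) ordIso_symmetric[OF card_of_Field_ordIso[OF Card_L]] by (rule ordLeq_ordIso_trans)
  ultimately obtain q where q: "q ` Field L = G"
    using card_of_ordLeq2[of G "Field L"] by blast
  have "\<exists>\<alpha>\<in>Field L. q \<alpha> = p i" for i using p(1)[of i] unfolding q[symmetric] by (auto simp: image_iff)
  then obtain F where F: "\<And>i. F i \<in> Field L" "\<And>i. q (F i) = p i" by metis
  have "eventually (\<lambda>i. \<alpha> \<in> underS L (F i)) d" if \<alpha>: "\<alpha> \<in> Field L" for \<alpha>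
  proof -
    have "|q ` (underS L \<alpha> \<union> {\<alpha>})| <o L"
      by (rule ordLeq_ordLess_trans[OF card_of_image
            Un_singleton_ordLess[OF Card_L inf_L card_of_underS[OF Card_L \<alpha>]]])
    moreover have "q ` (underS L \<alpha> \<union> {\<alpha>}) \<subseteq> G" using q \<alpha> underS_subset_Field[of L \<alpha>] by blast
    ultimately have "\<exists>h. (\<forall>x\<in>A. h x \<in> underS l x) \<and>
        (\<forall>g\<in>q ` (underS L \<alpha> \<union> {\<alpha>}). eventually (\<lambda>x. g x \<in> underS l (h x)) e)"
      unfolding card_less_L by (intro family_bounded) (use G(2) in blast)+
    then obtain h where h: "\<forall>x\<in>A. h x \<in> underS l x"
        "\<And>\<beta>. \<beta> \<in> underS L \<alpha> \<union> {\<alpha>} \<Longrightarrow> eventually (\<lambda>x. q \<beta> x \<in> underS l (h x)) e" by blast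
    have "eventually (\<lambda>i. \<forall>x\<in>A. x0 \<in> underS l x \<longrightarrow> h x \<in> underS l (t x i)) d"
    proof (rule complete_d)
      fix x assume x: "x \<in> A"
      show "eventually (\<lambda>i. x0 \<in> underS l x \<longrightarrow> h x \<in> underS l (t x i)) d"
        using t[OF x] h(1) x unfolding tail_def by (cases "x0 \<in> underS l x") auto
    qed
    thus ?thesis
    proof eventually_elim
      case (elim i)
      show ?case
      proof (rule ccontr)
        assume "\<alpha> \<notin> underS L (F i)"
        hence "(F i, \<alpha>) \<in> L" using L.not_lt \<alpha> F(1) by blast
        hence "F i \<in> underS L \<alpha> \<union> {\<alpha>}" by (auto simp: underS_iff)
        from h(2)[OF this] p(2)[of i] e_unbounded[OF x0] e_A have "eventually (\<lambda>x. False) e"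
        proof eventually_elim
          case (elim x)
          have "h x \<in> underS l (t x i)"
            using \<open>\<forall>x\<in>A. x0 \<in> underS l x \<longrightarrow> h x \<in> underS l (t x i)\<close> elim(3,4) by blast
          hence "h x \<in> underS l (p i x)" using elim(2) by (rule l.lt_le_trans)
          hence "(h x, p i x) \<in> l" by (rule l.lt_imp_le)
          moreover have "p i x \<in> underS l (h x)" using elim(1) F(2) by simp
          ultimately show False using l.lt_not_le by blast
        qed
        thus False using ultra_ex[OF ultra_e] by blast
      qed
    qed
  qed
  thus ?thesis using F(1) by blast
qed

end

section \<open>Decompositions, ultraproducts and the pseudopower\<close>

text \<open>The fibres of \<open>t\<close> form the partition. Its range is cofinal and so has size
  \<kappa> by regularity, while fewer than \<kappa> fibres have values below some \<alpha> and thus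
  miss a set in \<open>D\<close>.\<close>

lemma decomposableI:
  assumes U: "ultrafilter_on I D" and reg: "regular_cardinal \<kappa>"
    and t: "\<And>i. t i \<in> Field \<kappa>"
    and esc: "\<And>\<alpha>. \<alpha> \<in> Field \<kappa> \<Longrightarrow> eventually (\<lambda>i. \<alpha> \<in> underS \<kappa> (t i)) (set_filter I D)"
  shows "decomposable \<kappa> I D"
proof -
  have esc': "{i\<in>I. \<alpha> \<in> underS \<kappa> (t i)} \<in> D" if "\<alpha> \<in> Field \<kappa>" for \<alpha>
    using esc[OF that] by (simp add: eventually_set_filter[OF U])
  have D_empty: "{} \<notin> D" using U by (simp add: ultrafilter_on_def)
  define part where "part z = {i\<in>I. t i = z}" for z
  define P where "P = part ` (t ` I)"
  have inj: "inj_on part (t ` I)" unfolding inj_on_def part_def by blast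
  have "partition_on I P"
  proof (rule partition_onI)
    show "\<Union>P = I" by (auto simp: P_def part_def)
    show "{} \<notin> P" by (auto simp: P_def part_def)
    show "disjnt p p'" if "p \<in> P" "p' \<in> P" "p \<noteq> p'" for p p'
      using that by (auto simp: P_def part_def disjnt_def)
  qed
  moreover have "|P| =o \<kappa>"
  proof -
    have "\<exists>b\<in>t ` I. \<alpha> \<noteq> b \<and> (\<alpha>, b) \<in> \<kappa>" if "\<alpha> \<in> Field \<kappa>" for \<alpha>
    proof -
      have "{i\<in>I. \<alpha> \<in> underS \<kappa> (t i)} \<noteq> {}" using esc'[OF that] D_empty by metis
      thus ?thesis by (auto simp: underS_iff)
    qed
    hence "cofinal (t ` I) \<kappa>" unfolding cofinal_def by blast
    hence "|t ` I| =o \<kappa>" using reg t unfolding regular_cardinal_def regularCard_def by blast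
    moreover have "|t ` I| =o |P|"
      using inj unfolding P_def by (intro card_of_ordIsoI) (auto simp: bij_betw_def)
    ultimately show ?thesis using ordIso_symmetric ordIso_transitive by metis
  qed
  moreover have "\<Union>Q \<notin> D" if Q: "Q \<subseteq> P" "|Q| <o \<kappa>" for Q
  proof
    assume D: "\<Union>Q \<in> D"
    let ?Z = "{z\<in>t ` I. part z \<in> Q}"
    have "|?Z| \<le>o |Q|"
      by (rule card_of_ordLeqI[of part]) (use inj in \<open>auto simp: inj_on_def\<close>)
    hence "|?Z| <o \<kappa>" using Q(2) by (rule ordLeq_ordLess_trans)
    moreover have "?Z \<subseteq> Field \<kappa>" using t by blast
    ultimately obtain \<alpha> where \<alpha>: "\<alpha> \<in> Field \<kappa>" "\<forall>z\<in>?Z. z \<in> underS \<kappa> \<alpha>"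
      using regular_cardinal_bounded[OF reg, of ?Z] by auto
    interpret k: well_ordered \<kappa>
      by standard (use reg in \<open>auto simp: regular_cardinal_def card_order_on_def\<close>)
    have "\<Union>Q \<inter> {i\<in>I. \<alpha> \<in> underS \<kappa> (t i)} = {}"
    proof (rule ccontr)
      assume "\<not> ?thesis"
      then obtain i q where i: "q \<in> Q" "i \<in> q" "i \<in> I" "\<alpha> \<in> underS \<kappa> (t i)" by blast
      hence "q = part (t i)" using Q(1) by (auto simp: P_def part_def)
      hence "t i \<in> underS \<kappa> \<alpha>" using \<alpha>(2) i(1,3) by blast
      hence "(t i, \<alpha>) \<in> \<kappa>" by (rule k.lt_imp_le)
      thus False using k.lt_not_le[OF i(4)] by blast
    qed
    moreover have "\<Union>Q \<inter> {i\<in>I. \<alpha> \<in> underS \<kappa> (t i)} \<in> D"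
      by (rule ultrafilter_on_Int[OF U D esc'[OF \<alpha>(1)]])
    ultimately show False using D_empty by simp
  qed
  ultimately show ?thesis unfolding decomposable_def by blast
qed

text \<open>Let \<open>T\<close> be a cofinal subset of \<open>y\<close> of least size. If it is not
  smaller than \<open>x0\<close>, then |T| is a regular cardinal below \<lambda>, and a
  decomposition of \<open>D\<close> at |T| is transported into \<open>y\<close>.\<close>

lemma escape_or_cover:
  fixes l :: "'a rel" and D :: "'i set set"
  assumes Co: "Card_order l" and y: "y \<in> Field l" and U: "ultrafilter_on I D"
    and reg0: "regular_cardinal (initial_ordinal l x0)"
    and dec: "\<And>\<kappa> :: 'a rel. regular_cardinal \<kappa> \<Longrightarrow> initial_ordinal l x0 \<le>o \<kappa> \<Longrightarrow> \<kappa> <o l \<Longrightarrow> decomposable \<kappa> I D"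
  shows "(\<exists>T\<subseteq>underS l y. |T| <o |underS l x0| \<and> (\<forall>z\<in>underS l y. \<exists>w\<in>T. (z, w) \<in> l)) \<or>
      (\<exists>t. (\<forall>i. t i \<in> underS l y) \<and>
        (\<forall>z\<in>underS l y. eventually (\<lambda>i. z \<in> underS l (t i)) (set_filter I D)))"
proof -
  interpret l: well_ordered l
    by standard (use Co in \<open>simp add: card_order_on_def\<close>)
  define cov where "cov T \<longleftrightarrow> T \<subseteq> underS l y \<and> (\<forall>z\<in>underS l y. \<exists>w\<in>T. (z, w) \<in> l)" for T
  have "cov (underS l y)"
    using l.refl underS_subset_Field[of l y] unfolding cov_def by blast
  hence "\<exists>k\<in>{|T| | T. cov T}. \<forall>k'\<in>{|T| | T. cov T}. k \<le>o k'"
    by (intro exists_minim_Card_order) (auto simp: card_of_Card_order)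
  then obtain T where T: "cov T" and T_min: "\<And>T'. cov T' \<Longrightarrow> |T| \<le>o |T'|" by blast
  show ?thesis
  proof (cases "|T| <o |underS l x0|")
    case True
    thus ?thesis using T unfolding cov_def by blast
  next
    case False
    let ?k = "|T|"
    interpret k: well_ordered ?k by standard (rule card_of_Well_order)
    have x0_T: "|underS l x0| \<le>o ?k"
      using False by (simp add: not_ordLess_iff_ordLeq[OF card_of_Well_order card_of_Well_order])
    have x0_k: "initial_ordinal l x0 \<le>o ?k"
      using ordIso_symmetric[OF l.card_of_underS_regular[OF reg0]] x0_T by (rule ordIso_ordLeq_trans)
    have T_inf: "\<not> finite (Field ?k)"
      using x0_k reg0 cinfinite_mono unfolding regular_cardinal_def cinfinite_def by blast
    have k_Co: "Card_order ?k" by (rule card_of_Card_order)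
    have T_sub: "T \<subseteq> underS l y" using T by (simp add: cov_def)
    have bound: "\<exists>z\<in>underS l y. \<forall>w\<in>S. w \<in> underS l z" if S: "S \<subseteq> underS l y" "|S| <o ?k" for S
    proof -
      have "\<not> cov S" using T_min S(2) not_ordLess_ordLeq by blast
      then obtain z where z: "z \<in> underS l y" "\<forall>w\<in>S. (z, w) \<notin> l" using S(1) unfolding cov_def by blast
      have "w \<in> underS l z" if "w \<in> S" for w
        using l.not_lt[of w z] z that S(1) underS_FieldI[of _ l y] by blast
      thus ?thesis using z(1) by blast
    qed
    \<comment> \<open>\<open>T\<close> carries two orders, that of \<lambda> and the well-order |T|.
      \<open>z w\<close> will bound, in \<lambda>, everything up to \<open>w\<close> in |T|.\<close>
    have "\<exists>z\<in>underS l y. \<forall>w'\<in>T. (w', w) \<in> ?k \<longrightarrow> w' \<in> underS l z" if w: "w \<in> T" for w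
    proof -
      have "|underS ?k w \<union> {w}| <o ?k"
        using w by (intro Un_singleton_ordLess[OF k_Co T_inf] card_of_underS[OF k_Co]) (simp add: Field_card_of)
      moreover have "underS ?k w \<union> {w} \<subseteq> underS l y"
        using w T_sub underS_subset_Field[of ?k w] by (auto simp: Field_card_of)
      ultimately obtain z where z: "z \<in> underS l y" "\<forall>w'\<in>underS ?k w \<union> {w}. w' \<in> underS l z"
        using bound by blast
      hence "\<forall>w'\<in>T. (w', w) \<in> ?k \<longrightarrow> w' \<in> underS l z" by (auto simp: underS_iff[of _ ?k])
      thus ?thesis using z(1) by blast
    qed
    then obtain z where z: "\<And>w. w \<in> T \<Longrightarrow> z w \<in> underS l y"
        "\<And>w w'. w \<in> T \<Longrightarrow> w' \<in> T \<Longrightarrow> (w', w) \<in> ?k \<Longrightarrow> w' \<in> underS l (z w)" by metis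
    have k_reg: "regular_cardinal ?k"
      unfolding regular_cardinal_def regularCard_def cinfinite_def
    proof (intro conjI allI impI T_inf k_Co, elim conjE)
      fix K assume K: "K \<subseteq> Field ?k" "cofinal K ?k"
      hence K_T: "K \<subseteq> T" by (simp add: Field_card_of)
      \<comment> \<open>A set \<open>K\<close> cofinal in |T| has an image under \<open>z\<close>
        that is cofinal in \<open>y\<close>, so it cannot be smaller than |T|.\<close>
      have "\<not> |K| <o ?k"
      proof
        assume "|K| <o ?k"
        hence "|z ` K| <o ?k" by (rule ordLeq_ordLess_trans[OF card_of_image])
        moreover have "z ` K \<subseteq> underS l y" using z(1) K_T by blast
        ultimately obtain v where v: "v \<in> underS l y" "\<forall>w\<in>z ` K. w \<in> underS l v"
          using bound by blast
        obtain w where w: "w \<in> T" "(v, w) \<in> l" using T v(1) unfolding cov_def by blast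
        obtain w' where w': "w' \<in> K" "(w, w') \<in> ?k"
          using K(2) w(1) unfolding cofinal_def by (auto simp: Field_card_of)
        have "w \<in> underS l (z w')" using z(2)[of w' w] w' w(1) K_T by blast
        moreover have "z w' \<in> underS l v" using v(2) w'(1) by blast
        ultimately have "w \<in> underS l v" by (rule l.lt_trans)
        thus False using w(2) l.lt_not_le by blast
      qed
      moreover have "|K| \<le>o ?k" using K_T by (rule card_of_mono1)
      ultimately show "|K| =o ?k" using ordLeq_iff_ordLess_or_ordIso by blast
    qed
    have k_l: "?k <o l"
      using card_of_mono1[OF T_sub] card_of_underS[OF Co y] by (rule ordLeq_ordLess_trans)
    obtain P where P: "partition_on I P" "|P| =o ?k" "\<And>Q. Q \<subseteq> P \<Longrightarrow> |Q| <o ?k \<Longrightarrow> \<Union>Q \<notin> D"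
      using dec[OF k_reg x0_k k_l] unfolding decomposable_def by blast
    obtain b where b: "bij_betw b P T" using P(2) card_of_ordIso by blast
    obtain w0 where w0: "w0 \<in> T" using T_inf by (force simp: Field_card_of)
    \<comment> \<open>\<open>p i\<close> is the label in \<open>T\<close> of the piece containing
      \<open>i\<close>; outside \<open>I\<close> the label \<open>w0\<close> is arbitrary.\<close>
    define p where "p i = (if i \<in> I then b (THE X. X \<in> P \<and> i \<in> X) else w0)" for i
    have part: "p i = b X" if "X \<in> P" "i \<in> X" for i X
    proof -
      have "(THE X. X \<in> P \<and> i \<in> X) = X"
        using partition_onD2[OF P(1)] that unfolding disjoint_def by (intro the_equality) blast+
      moreover have "i \<in> I" using partition_onD1[OF P(1)] that by blast
      ultimately show ?thesis by (simp add: p_def)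
    qed
    have p_T: "p i \<in> T" for i
    proof (cases "i \<in> I")
      case True
      then obtain X where "X \<in> P" "i \<in> X" using partition_onD1[OF P(1)] by blast
      thus ?thesis using part b bij_betwE by metis
    qed (simp add: p_def w0)
    have "eventually (\<lambda>i. v \<in> underS l (z (p i))) (set_filter I D)" if v: "v \<in> underS l y" for v
    proof -
      obtain w where w: "w \<in> T" "(v, w) \<in> l" using T v unfolding cov_def by blast
      \<comment> \<open>The pieces labelled before \<open>w\<close> are fewer than |T|, so most
        \<open>i\<close> have labels from \<open>w\<close> on, and there \<open>z (p i)\<close>
        exceeds \<open>w\<close>, hence \<open>v\<close>.\<close>
      let ?Q = "{X\<in>P. b X \<in> underS ?k w}"
      have "|?Q| \<le>o |underS ?k w|"
        by (rule card_of_ordLeqI[of b]) (use b in \<open>auto simp: bij_betw_def inj_on_def\<close>)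
      moreover have "|underS ?k w| <o ?k" using w(1) by (intro card_of_underS[OF k_Co]) (simp add: Field_card_of)
      ultimately have "\<Union>?Q \<notin> D" by (intro P(3)) (auto intro: ordLeq_ordLess_trans)
      moreover have "\<Union>?Q = {i\<in>I. p i \<in> underS ?k w}"
        using partition_onD1[OF P(1)] part by fastforce
      ultimately have "\<not> eventually (\<lambda>i. p i \<in> underS ?k w) (set_filter I D)"
        by (simp add: eventually_set_filter[OF U])
      hence "eventually (\<lambda>i. p i \<notin> underS ?k w) (set_filter I D)"
        by (simp add: ultra_not[OF ultra_set_filter[OF U]])
      thus ?thesis
      proof eventually_elim
        case (elim i)
        have "(w, p i) \<in> ?k" using elim k.not_lt[of "p i" w] p_T[of i] w(1) by (simp add: Field_card_of)
        hence "w \<in> underS l (z (p i))" using z(2) p_T w(1) by blast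
        thus ?case using l.le_lt_trans[OF w(2)] by blast
      qed
    qed
    thus ?thesis using z(1)[OF p_T] by (intro disjI2 exI[of _ "\<lambda>i. z (p i)"]) blast
  qed
qed

text \<open>Zorn's lemma gives a minimal proper filter below \<open>F\<close>; the infimum of a
  chain of proper filters is proper. Adding \<open>P\<close> to a minimal filter yields either
  \<open>bot\<close> or the same filter.\<close>

lemma ultra_exists:
  fixes F :: "'c filter"
  assumes "F \<noteq> bot"
  shows "\<exists>G\<le>F. ultra G"
proof -
  let ?S = "{G. G \<noteq> bot \<and> G \<le> F}"
  have "\<exists>m\<in>?S. \<forall>G\<in>?S. m \<ge> G \<longrightarrow> G = m"
  proof (rule predicate_Zorn)
    show "partial_order_on ?S (relation_of (\<ge>) ?S)"
      by (rule partial_order_on_relation_ofI) auto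
    fix C assume C: "C \<in> Chains (relation_of (\<ge>) ?S)"
    hence C_S: "G \<in> ?S" if "G \<in> C" for G
      using that unfolding Chains_def relation_of_def by blast
    have chain: "G \<le> H \<or> H \<le> G" if "G \<in> C" "H \<in> C" for G H
      using that C unfolding Chains_def relation_of_def by blast
    show "\<exists>u\<in>?S. \<forall>G\<in>C. G \<ge> u"
    proof (cases "C = {}")
      case True
      thus ?thesis using assms by blast
    next
      case False
      have "eventually (\<lambda>_. False) (Inf C) \<longleftrightarrow> (\<exists>G\<in>C. eventually (\<lambda>_. False) G)"
      proof (rule eventually_Inf_base[OF False])
        fix G H assume GH: "G \<in> C" "H \<in> C"
        show "\<exists>x\<in>C. x \<le> inf G H"
          using chain[OF GH] GH by (auto simp: inf_absorb1 inf_absorb2)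
      qed
      hence "Inf C \<noteq> bot" using C_S by (auto simp: trivial_limit_def)
      moreover obtain G where "G \<in> C" using False by blast
      hence "Inf C \<le> F" using C_S[of G] Inf_lower[of G C] by (auto intro: order_trans)
      ultimately show ?thesis by (intro bexI[of _ "Inf C"] ballI Inf_lower) auto
    qed
  qed
  then obtain G where G: "G \<noteq> bot" "G \<le> F" "\<And>H. H \<noteq> bot \<Longrightarrow> H \<le> F \<Longrightarrow> H \<le> G \<Longrightarrow> H = G"
    by blast
  have "eventually P G \<or> eventually (\<lambda>x. \<not> P x) G" for P
  proof (cases "inf G (principal {x. P x}) = bot")
    case True
    hence "eventually (\<lambda>x. \<not> P x) G"
      by (simp add: trivial_limit_def eventually_inf_principal)
    thus ?thesis ..
  next
    case False
    hence "inf G (principal {x. P x}) = G"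
      using G(2) by (intro G(3)) (auto intro: le_infI1)
    moreover have "eventually P (inf G (principal {x. P x}))"
      by (simp add: eventually_inf_principal)
    ultimately show ?thesis by simp
  qed
  thus ?thesis using G(1,2) unfolding ultra_def by blast
qed

section \<open>The cofinality of the ultraproduct\<close>

lemma cofinal_Field:
  assumes "Card_order l" "\<not> finite (Field l)"
  shows "cofinal (Field l) l"
  using infinite_Card_order_limit[OF assms] unfolding cofinal_def by blast

text \<open>The classes of a cofinal family give the upper bound. Representatives of a cofinal set
  of size at most \<lambda> would be bounded by \<open>family_bounded\<close>, which gives the lower
  bound.\<close>

lemma cofinality_ultraproduct:
  assumes ep: "escaping_product l x0 A d (set_filter A E)" and E: "ultrafilter_on A E"
  shows "Card_order (cofinality (ultraproduct A E (initial_ordinal l)))"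
    and "cofinality (ultraproduct A E (initial_ordinal l)) =o cardSuc l"
proof -
  interpret escaping_product l x0 A d "set_filter A E" by (rule ep)
  let ?s = "initial_ordinal l" and ?e = "set_filter A E"
  let ?r = "ultraproduct A E ?s"
  let ?c = "\<lambda>f. ultraproduct_eq A E ?s `` {f}"
  let ?P = "\<Pi>\<^sub>E x\<in>A. Field (?s x)"
  have P_iff: "f \<in> ?P \<longleftrightarrow> f \<in> extensional A \<and> (\<forall>x\<in>A. f x \<in> underS l x)" for f
    by (auto simp: PiE_def l.Field_initial_ordinal)
  have s_lin: "Linear_order (?s x)" if "x \<in> A" for x
    using regular[OF that] by (simp add: regular_cardinal_def card_order_on_def well_order_on_def)
  have Field_r: "Field ?r = ?P // ultraproduct_eq A E ?s" and r_lin: "Linear_order ?r"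
    by (rule Linear_order_ultraproduct[OF E s_lin], assumption)+
  have c_in: "?c f \<in> Field ?r" if "f \<in> ?P" for f
    unfolding Field_r by (rule quotientI[OF that])
  have le_iff: "(?c f, ?c g) \<in> ?r \<longleftrightarrow> eventually (\<lambda>x. (f x, g x) \<in> l) ?e"
    if f: "f \<in> ?P" and g: "g \<in> ?P" for f g
  proof -
    have "{x\<in>A. (f x, g x) \<in> ?s x} = {x\<in>A. (f x, g x) \<in> l}"
      using f g by (auto simp: P_iff l.initial_ordinal_iff)
    thus ?thesis unfolding ultraproduct_iff[OF E f g] eventually_set_filter[OF E] by simp
  qed
  have less_iff: "?c f \<noteq> ?c g \<and> (?c f, ?c g) \<in> ?r \<longleftrightarrow> eventually (\<lambda>x. f x \<in> underS l (g x)) ?e"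
    if f: "f \<in> ?P" and g: "g \<in> ?P" for f g
  proof -
    have "?c f \<noteq> ?c g \<and> (?c f, ?c g) \<in> ?r \<longleftrightarrow> (?c g, ?c f) \<notin> ?r"
      using r_lin c_in[OF f] c_in[OF g] unfolding order_on_defs refl_on_def total_on_def antisym_def
      by metis
    also have "\<dots> \<longleftrightarrow> eventually (\<lambda>x. (g x, f x) \<notin> l) ?e"
      unfolding le_iff[OF g f] by (rule ultra_not[OF ultra_e])
    also have "\<dots> \<longleftrightarrow> eventually (\<lambda>x. f x \<in> underS l (g x)) ?e"
    proof (rule eventually_subst)
      from e_A show "eventually (\<lambda>x. ((g x, f x) \<notin> l) = (f x \<in> underS l (g x))) ?e"
      proof eventually_elim
        case (elim x)
        have "f x \<in> underS l x" "g x \<in> underS l x" using f g elim P_iff by blast+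
        thus ?case using l.not_lt[of "f x" "g x"] underS_FieldI[of _ l x] by blast
      qed
    qed
    finally show ?thesis .
  qed
  obtain G where G: "|G| \<le>o L" "\<And>g x. g \<in> G \<Longrightarrow> x \<in> A \<Longrightarrow> g x \<in> underS l x"
      "\<And>h. \<forall>x\<in>A. h x \<in> underS l x \<Longrightarrow> \<exists>g\<in>G. eventually (\<lambda>x. (h x, g x) \<in> l) ?e"
    using cofinal_family by blast
  have restrict_P: "restrict g A \<in> ?P" if "\<forall>x\<in>A. g x \<in> underS l x" for g
    using that by (simp add: P_iff)
  define K where "K = (\<lambda>g. ?c (restrict g A)) ` G"
  have K_Field: "K \<subseteq> Field ?r"
    using c_in[OF restrict_P] G(2) unfolding K_def by blast
  have K_cofinal: "cofinal K ?r"
    unfolding cofinal_def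
  proof
    fix X assume "X \<in> Field ?r"
    then obtain f where f: "f \<in> ?P" "X = ?c f" unfolding Field_r by (auto elim!: quotientE)
    have f_l: "f x \<in> underS l x" if "x \<in> A" for x using f(1) P_iff that by blast
    have "|{f}| \<le>o l"
      using inf Co by (intro ordLess_imp_ordLeq finite_ordLess_infinite card_of_Well_order)
        (simp_all add: Field_card_of card_order_on_def)
    \<comment> \<open>\<open>cofinal\<close> asks for strict bounds, so \<open>f\<close> is first
      raised strictly to \<open>h\<close>, and only then is \<open>h\<close> dominated by a member
      of \<open>G\<close>.\<close>
    hence "\<exists>h. (\<forall>x\<in>A. h x \<in> underS l x) \<and> (\<forall>g\<in>{f}. eventually (\<lambda>x. g x \<in> underS l (h x)) ?e)"
      by (rule family_bounded) (use f_l in blast)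
    then obtain h where h: "\<forall>x\<in>A. h x \<in> underS l x" "eventually (\<lambda>x. f x \<in> underS l (h x)) ?e" by blast
    obtain g where g: "g \<in> G" "eventually (\<lambda>x. (h x, g x) \<in> l) ?e" using G(3)[OF h(1)] by blast
    have gP: "restrict g A \<in> ?P" by (rule restrict_P) (use G(2) g(1) in blast)
    from h(2) g(2) e_A have "eventually (\<lambda>x. f x \<in> underS l (restrict g A x)) ?e"
      by eventually_elim (simp add: l.lt_le_trans)
    hence "X \<noteq> ?c (restrict g A) \<and> (X, ?c (restrict g A)) \<in> ?r"
      using less_iff[OF f(1) gP] f(2) by simp
    thus "\<exists>b\<in>K. X \<noteq> b \<and> (X, b) \<in> ?r" using g(1) unfolding K_def by blast
  qed
  have "cofinal (Field ?r) ?r" using K_cofinal K_Field unfolding cofinal_def by blast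
  then obtain M where M: "M \<subseteq> Field ?r" "cofinal M ?r" "cofinality ?r = |M|"
    by (rule cofinality_witness)
  show "Card_order (cofinality ?r)" unfolding M(3) by (rule card_of_Card_order)
  have "|K| \<le>o L" unfolding K_def using card_of_image G(1) by (rule ordLeq_transitive)
  hence upper: "cofinality ?r \<le>o L" using cofinality_le[OF K_Field K_cofinal] ordLeq_transitive by blast
  have lower: "L \<le>o cofinality ?r"
  proof (rule ccontr)
    assume "\<not> L \<le>o cofinality ?r"
    hence "|M| <o L"
      unfolding M(3) by (simp add: not_ordLeq_iff_ordLess[OF card_of_Well_order L.Wo])
    hence M_l: "|M| \<le>o l" by (simp add: card_less_L)
    have "\<exists>f. f \<in> ?P \<and> X = ?c f" if "X \<in> M" for X
      using M(1) that unfolding Field_r by (auto elim!: quotientE)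
    then obtain rep where rep: "\<And>X. X \<in> M \<Longrightarrow> rep X \<in> ?P" "\<And>X. X \<in> M \<Longrightarrow> X = ?c (rep X)" by metis
    have "|rep ` M| \<le>o l" using card_of_image M_l by (rule ordLeq_transitive)
    hence "\<exists>h. (\<forall>x\<in>A. h x \<in> underS l x) \<and> (\<forall>g\<in>rep ` M. eventually (\<lambda>x. g x \<in> underS l (h x)) ?e)"
      by (rule family_bounded) (use rep(1) P_iff in blast)
    then obtain h where h: "\<forall>x\<in>A. h x \<in> underS l x"
        "\<And>X. X \<in> M \<Longrightarrow> eventually (\<lambda>x. rep X x \<in> underS l (h x)) ?e" by blast
    have hP: "restrict h A \<in> ?P" by (rule restrict_P[OF h(1)])
    obtain X where X: "X \<in> M" "?c (restrict h A) \<noteq> X" "(?c (restrict h A), X) \<in> ?r"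
      using M(2) c_in[OF hP] unfolding cofinal_def by blast
    have "?c (restrict h A) \<noteq> ?c (rep X) \<and> (?c (restrict h A), ?c (rep X)) \<in> ?r"
      using X rep(2)[OF X(1)] by simp
    hence "eventually (\<lambda>x. restrict h A x \<in> underS l (rep X x)) ?e"
      using less_iff[OF hP rep(1)[OF X(1)]] by blast
    from this h(2)[OF X(1)] e_A have "eventually (\<lambda>x. False) ?e"
    proof eventually_elim
      case (elim x)
      hence "h x \<in> underS l (rep X x)" by simp
      thus ?case using l.lt_not_le[OF elim(2)] l.lt_imp_le by blast
    qed
    thus False using ultra_ex[OF ultra_e] by blast
  qed
  show "cofinality ?r =o L" using upper lower ordIso_iff_ordLeq by blast
qed

section \<open>Regular cardinals below \<lambda> and sets for the pseudopower\<close>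

lemma regular_below_singular:
  assumes l: "singular_cardinal l" and y: "y \<in> Field l"
  shows "\<exists>x\<in>Field l. regular_cardinal (initial_ordinal l x) \<and> y \<in> underS l x"
proof -
  have Co: "Card_order l" and inf: "\<not> finite (Field l)" and sing: "\<not> regularCard l"
    using l by (auto simp: singular_cardinal_def cinfinite_def)
  interpret l: well_ordered l
    by standard (use Co in \<open>simp add: card_order_on_def\<close>)
  have not_iso: "\<not> \<kappa> =o l" if "regular_cardinal \<kappa>" for \<kappa> :: "'c rel"
    using that regularCard_ordIso[of \<kappa> l] sing unfolding regular_cardinal_def by blast
  have below: "\<exists>a\<in>Field l. \<kappa> =o initial_ordinal l a" if "regular_cardinal \<kappa>" "\<kappa> \<le>o l" for \<kappa> :: "'c rel"
  proof -
    have "\<kappa> <o l" using not_iso[OF that(1)] that(2) ordLeq_iff_ordLess_or_ordIso by blast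
    moreover have "Well_order \<kappa>" using that(1) by (simp add: regular_cardinal_def card_order_on_def)
    ultimately show ?thesis
      unfolding initial_ordinal_def using ordLess_iff_ordIso_Restr[OF l.Wo] by blast
  qed
  \<comment> \<open>\<open>w\<close> stands for \<omega>, which is regular and so below \<lambda>.
    Taking \<open>u\<close> from \<open>w\<close> on makes |u| infinite and its successor
    regular.\<close>
  have "natLeq \<le>o l" using Co inf by (intro natLeq_ordLeq_cinfinite) (simp add: cinfinite_def)
  moreover have "regular_cardinal natLeq"
    by (simp add: regular_cardinal_def natLeq_Cinfinite regularCard_natLeq)
  ultimately obtain w where w: "w \<in> Field l" "natLeq =o initial_ordinal l w"
    using below by blast
  have w_inf: "\<not> finite (underS l w)"
    using card_of_ordIso_finite[OF card_of_cong[OF w(2)]] natLeq_cinfinite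
    by (simp add: l.Field_initial_ordinal cinfinite_def)
  obtain u where u: "u \<in> Field l" "(y, u) \<in> l" "(w, u) \<in> l"
    using l.total[OF y w(1)] l.refl y w(1) by blast
  have "underS l w \<subseteq> underS l u" using l.lt_le_trans[OF _ u(3)] by blast
  hence u_inf: "Cinfinite |underS l u|"
    using w_inf finite_subset by (auto simp: cinfinite_def Field_card_of card_of_card_order_on)
  \<comment> \<open>This successor is at most \<lambda> and, being regular, not equal to it. Its
    ordinal \<open>x\<close> lies above \<open>u\<close>, as otherwise |x| \<le> |u|.\<close>
  let ?\<kappa> = "cardSuc |underS l u|"
  have \<kappa>: "regular_cardinal ?\<kappa>"
    by (simp add: regular_cardinal_def Cinfinite_cardSuc[OF u_inf] regularCard_cardSuc[OF u_inf])
  have "?\<kappa> \<le>o l"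
    using cardSuc_least[OF card_of_Card_order Co] card_of_underS[OF Co u(1)] by blast
  then obtain x where x: "x \<in> Field l" "?\<kappa> =o initial_ordinal l x" using below[OF \<kappa>] by blast
  have reg: "regular_cardinal (initial_ordinal l x)"
    using \<kappa> Cinfinite_cong[OF x(2)] regularCard_ordIso[OF x(2)] unfolding regular_cardinal_def by blast
  have "u \<in> underS l x"
  proof (rule ccontr)
    assume "u \<notin> underS l x"
    hence "(x, u) \<in> l" using l.not_lt u(1) x(1) by blast
    hence "underS l x \<subseteq> underS l u" using l.lt_le_trans by blast
    hence "|underS l x| \<le>o |underS l u|" by (rule card_of_mono1)
    hence "initial_ordinal l x \<le>o |underS l u|"
      by (rule ordIso_ordLeq_trans[OF ordIso_symmetric[OF l.card_of_underS_regular[OF reg]]])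
    hence "?\<kappa> \<le>o |underS l u|" by (rule ordIso_ordLeq_trans[OF x(2)])
    thus False using cardSuc_greater[OF card_of_Card_order] not_ordLess_ordLeq by blast
  qed
  hence "y \<in> underS l x" by (rule l.le_lt_trans[OF u(2)])
  thus ?thesis using x(1) reg by blast
qed

text \<open>This keeps the supremum defining \<open>pp\<close> from being taken over the empty set.
  \<open>A\<close> replaces each member of a least cofinal set by a regular cardinal above it, and
  \<open>E\<close> extends the filter of tails.\<close>

lemma pp_pair_exists:
  assumes l: "singular_cardinal l"
  shows "\<exists>A E. pp_pair l A E"
proof -
  have Co: "Card_order l" and inf: "\<not> finite (Field l)"
    using l by (auto simp: singular_cardinal_def cinfinite_def)
  interpret l: well_ordered l
    by standard (use Co in \<open>simp add: card_order_on_def\<close>)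
  obtain K where K: "K \<subseteq> Field l" "cofinal K l" "cofinality l = |K|"
    using cofinality_witness[OF cofinal_Field[OF Co inf]] by blast
  obtain h where h: "\<And>y. y \<in> Field l \<Longrightarrow> h y \<in> Field l \<and> regular_cardinal (initial_ordinal l (h y)) \<and> y \<in> underS l (h y)"
    using regular_below_singular[OF l] by metis
  define A where "A = h ` K"
  have A_sub: "A \<subseteq> Field l" and A_reg: "\<forall>x\<in>A. regular_cardinal (initial_ordinal l x)"
    using h K(1) unfolding A_def by blast+
  have A_ex: "\<exists>b\<in>A. y \<in> underS l b" if y: "y \<in> Field l" for y
  proof -
    obtain k where k: "k \<in> K" "(y, k) \<in> l" using K(2) y unfolding cofinal_def by blast
    have "k \<in> underS l (h k)" using h K(1) k(1) by blast
    hence "y \<in> underS l (h k)" by (rule l.le_lt_trans[OF k(2)])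
    thus ?thesis using k(1) unfolding A_def by blast
  qed
  have "|A| \<le>o cofinality l" unfolding A_def K(3) by (rule card_of_image)
  have A_cof: "cofinal A l" using A_ex unfolding cofinal_def underS_iff by blast
  define tail where "tail y = principal {x\<in>A. y \<in> underS l x}" for y
  define F where "F = (INF y\<in>Field l. tail y)"
  have Field_ne: "Field l \<noteq> {}" using inf by auto
  have F_iff: "eventually P F \<longleftrightarrow> (\<exists>y\<in>Field l. \<forall>x\<in>A. y \<in> underS l x \<longrightarrow> P x)" for P
  proof -
    have "eventually P F \<longleftrightarrow> (\<exists>b\<in>tail ` Field l. eventually P b)"
      unfolding F_def
    proof (rule eventually_Inf_base)
      fix G H assume "G \<in> tail ` Field l" "H \<in> tail ` Field l"
      then obtain y z where yz: "y \<in> Field l" "z \<in> Field l" "G = tail y" "H = tail z" by blast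
      obtain u where u: "u \<in> Field l" "(y, u) \<in> l" "(z, u) \<in> l"
        using l.total[OF yz(1,2)] l.refl yz(1,2) by blast
      have "tail u \<le> inf (tail y) (tail z)"
        unfolding tail_def using l.le_lt_trans[OF u(2)] l.le_lt_trans[OF u(3)] by auto
      thus "\<exists>x\<in>tail ` Field l. x \<le> inf G H" using u(1) yz by blast
    qed (use Field_ne in blast)
    thus ?thesis by (auto simp: tail_def eventually_principal)
  qed
  have "F \<noteq> bot" unfolding trivial_limit_def F_iff using A_ex by blast
  then obtain G where G: "G \<le> F" "ultra G" using ultra_exists by blast
  have GA: "eventually (\<lambda>x. x \<in> A) G"
    by (rule filter_leD[OF G(1)]) (use Field_ne in \<open>auto simp: F_iff\<close>)
  have G_tail: "eventually (\<lambda>x. y \<in> underS l x) G" if "y \<in> Field l" for y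
    by (rule filter_leD[OF G(1)]) (use that in \<open>auto simp: F_iff\<close>)
  define E where "E = {X. X \<subseteq> A \<and> eventually (\<lambda>x. x \<in> X) G}"
  have "ultrafilter_on A E"
    unfolding ultrafilter_on_def
  proof (intro conjI ballI allI impI)
    show "E \<subseteq> Pow A" "A \<in> E" using GA by (auto simp: E_def)
    show "{} \<notin> E" using ultra_ex[OF G(2), of "\<lambda>x. x \<in> {}"] by (auto simp: E_def)
    show "Y \<in> E" if "X \<in> E" "X \<subseteq> Y \<and> Y \<subseteq> A" for X Y
      using that by (auto simp: E_def elim: eventually_mono)
    show "X \<inter> Y \<in> E" if "X \<in> E" "Y \<in> E" for X Y
      using that by (auto simp: E_def intro: eventually_conj)
    show "X \<in> E \<or> A - X \<in> E" if "X \<subseteq> A" for X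
    proof (cases "eventually (\<lambda>x. x \<in> X) G")
      case False
      hence "eventually (\<lambda>x. x \<notin> X) G" by (simp add: ultra_not[OF G(2)])
      with GA have "eventually (\<lambda>x. x \<in> A - X) G" by eventually_elim simp
      thus ?thesis by (simp add: E_def)
    qed (use that in \<open>simp add: E_def\<close>)
  qed
  moreover have "cofinal X l" if X: "X \<in> E" for X
  proof -
    have "\<exists>b\<in>X. y \<in> underS l b" if y: "y \<in> Field l" for y
      using ultra_ex[OF G(2) eventually_conj[OF G_tail[OF y]], of "\<lambda>x. x \<in> X"] X
      by (auto simp: E_def)
    thus ?thesis unfolding cofinal_def underS_iff by blast
  qed
  ultimately show ?thesis
    unfolding pp_pair_def using A_sub A_reg A_cof \<open>|A| \<le>o cofinality l\<close> by blast
qed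

section \<open>Assembling the hypotheses and the conclusion\<close>

lemma escaping_product_pp_pair:
  fixes l :: "'a rel" and D :: "'i set set"
  assumes l: "singular_cardinal l" and U: "ultrafilter_on I D"
    and complete: "complete_filter (cardSuc (cofinality l)) D"
    and x0: "x0 \<in> Field l" "regular_cardinal (initial_ordinal l x0)"
    and dec: "\<And>\<kappa> :: 'a rel. regular_cardinal \<kappa> \<Longrightarrow> initial_ordinal l x0 \<le>o \<kappa> \<Longrightarrow> \<kappa> <o l \<Longrightarrow> decomposable \<kappa> I D"
    and pair: "pp_pair l A E"
  shows "escaping_product l x0 A (set_filter I D) (set_filter A E)"
proof -
  have Co: "Card_order l" and inf: "\<not> finite (Field l)"
    using l by (auto simp: singular_cardinal_def cinfinite_def)
  have A: "A \<subseteq> Field l" "\<And>x. x \<in> A \<Longrightarrow> regular_cardinal (initial_ordinal l x)" "cofinal A l"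
      "|A| \<le>o cofinality l" and E: "ultrafilter_on A E" and E_cof: "\<And>B. B \<in> E \<Longrightarrow> cofinal B l"
    using pair unfolding pp_pair_def by blast+
  let ?d = "set_filter I D" and ?e = "set_filter A E"
  interpret l: well_ordered l
    by standard (use Co in \<open>simp add: card_order_on_def\<close>)
  interpret complete_ultra A ?d
  proof
    show "ultra ?d" by (rule ultra_set_filter[OF U])
    fix P assume P: "\<And>\<xi>. \<xi> \<in> A \<Longrightarrow> eventually (P \<xi>) ?d"
    let ?S = "(\<lambda>\<xi>. {i\<in>I. P \<xi> i}) ` A"
    \<comment> \<open>\<open>complete_filter\<close> speaks of nonempty families only.\<close>
    have "A \<noteq> {}" using A(3) inf unfolding cofinal_def by (auto dest: infinite_imp_nonempty)
    moreover have "Card_order (cofinality l)"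
      using cofinality_witness[OF cofinal_Field[OF Co inf]] card_of_Card_order by metis
    hence "|?S| <o cardSuc (cofinality l)"
      unfolding cardSuc_ordLeq_ordLess[OF \<open>Card_order (cofinality l)\<close> card_of_Card_order]
      using card_of_image A(4) by (blast intro: ordLeq_transitive)
    moreover have "?S \<subseteq> D" using P by (auto simp: eventually_set_filter[OF U])
    ultimately have "\<Inter>?S \<in> D" using complete unfolding complete_filter_def by blast
    moreover have "\<Inter>?S = {i\<in>I. \<forall>\<xi>\<in>A. P \<xi> i}" using \<open>A \<noteq> {}\<close> by blast
    ultimately show "eventually (\<lambda>i. \<forall>\<xi>\<in>A. P \<xi> i) ?d" by (simp add: eventually_set_filter[OF U])
  qed
  note escape = escape_or_cover[OF Co _ U x0(2) dec]
  \<comment> \<open>An injection of \<rho> into \<open>Pow A\<close>, composed with an escaping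
    function into \<rho>, would be constant on a large set by \<open>d_const\<close>, so the
    escaping function would be constant there.\<close>
  have Pow_A: "|Pow A| <o |underS l x0|"
  proof (rule ccontr)
    assume "\<not> ?thesis"
    hence "|underS l x0| \<le>o |Pow A|"
      by (simp add: not_ordLess_iff_ordLeq[OF card_of_Well_order card_of_Well_order])
    then obtain h where h: "inj_on h (underS l x0)" "h ` underS l x0 \<subseteq> Pow A"
      using card_of_ordLeq[of "underS l x0" "Pow A"] by blast
    have "\<exists>t. (\<forall>i. t i \<in> underS l x0) \<and> (\<forall>z\<in>underS l x0. eventually (\<lambda>i. z \<in> underS l (t i)) ?d)"
      by (rule disjE[OF escape[OF x0(1)] notE[OF l.regular_not_covered[OF x0(2)]]])
    then obtain t where t: "\<And>i. t i \<in> underS l x0"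
        "\<And>z. z \<in> underS l x0 \<Longrightarrow> eventually (\<lambda>i. z \<in> underS l (t i)) ?d" by blast
    obtain S where S: "eventually (\<lambda>i. h (t i) = S) ?d"
      using d_const[of "\<lambda>i. h (t i)"] h(2) t(1) by blast
    obtain i where i: "h (t i) = S" using ultra_ex[OF ultra_d S] by blast
    obtain j where j: "h (t j) = S" "t i \<in> underS l (t j)"
      using ultra_ex[OF ultra_d eventually_conj[OF S t(2)[OF t(1)[of i]]]] by blast
    have "t i = t j" using inj_onD[OF h(1)] i j(1) t(1) by metis
    thus False using j(2) by (simp add: underS_iff)
  qed
  have "eventually (\<lambda>x. y \<in> underS l x) ?e" if y: "y \<in> Field l" for y
  proof (rule ccontr)
    assume "\<not> ?thesis"
    hence "eventually (\<lambda>x. y \<notin> underS l x) ?e"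
      by (rule ultra_not[OF ultra_set_filter[OF E], THEN iffD1])
    hence "{x\<in>A. y \<notin> underS l x} \<in> E" by (simp add: eventually_set_filter[OF E])
    thus False using E_cof y unfolding cofinal_def underS_iff by blast
  qed
  moreover have "A \<in> E" using E by (simp add: ultrafilter_on_def)
  ultimately show ?thesis
    using Co inf A x0 Pow_A escape ultra_set_filter[OF E]
    by unfold_locales (auto simp: eventually_set_filter[OF E])
qed

theorem theorem2p3:
  fixes l :: "'a rel" and I :: "'i set" and D :: "'i set set"
  assumes "singular_cardinal l"
    and "ultrafilter_on I D"
    and "complete_filter (cardSuc (cofinality l)) D"
    and "\<exists>l' :: 'a rel. Card_order l' \<and> l' <o l \<and>
           (\<forall>\<kappa> :: 'a rel. regular_cardinal \<kappa> \<and> l' \<le>o \<kappa> \<and> \<kappa> <o l \<longrightarrow> decomposable \<kappa> I D)"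
  shows "decomposable (cardSuc l) I D \<and> pp l =o cardSuc l"
proof -
  note l = assms(1) and U = assms(2)
  have Co: "Card_order l" using l by (simp add: singular_cardinal_def)
  interpret l: well_ordered l
    by standard (use Co in \<open>simp add: card_order_on_def\<close>)
  obtain l' :: "'a rel" where l': "Card_order l'" "l' <o l"
      and dec: "\<And>\<kappa> :: 'a rel. regular_cardinal \<kappa> \<Longrightarrow> l' \<le>o \<kappa> \<Longrightarrow> \<kappa> <o l \<Longrightarrow> decomposable \<kappa> I D"
    using assms(4) by blast
  obtain a where a: "a \<in> Field l" "l' =o initial_ordinal l a"
    using l'(2) ordLess_iff_ordIso_Restr[OF l.Wo, of l'] l'(1)
    unfolding initial_ordinal_def card_order_on_def by blast
  \<comment> \<open>\<rho> is a regular cardinal above the given \<lambda>', so decomposability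
    holds from \<rho> on.\<close>
  obtain x0 where x0: "x0 \<in> Field l" "regular_cardinal (initial_ordinal l x0)" "a \<in> underS l x0"
    using regular_below_singular[OF l a(1)] by blast
  have "|Field l'| =o |underS l a|"
    using card_of_cong[OF a(2)] by (simp add: l.Field_initial_ordinal)
  hence "l' =o |underS l a|" by (rule ordIso_transitive[OF ordIso_symmetric[OF card_of_Field_ordIso[OF l'(1)]]])
  moreover have "|underS l a| \<le>o |underS l x0|"
    using l.card_of_underS_less[OF x0(2,3)] by (rule ordLess_imp_ordLeq)
  ultimately have "l' \<le>o |underS l x0|" by (rule ordIso_ordLeq_trans)
  hence l'_x0: "l' \<le>o initial_ordinal l x0"
    by (rule ordLeq_ordIso_trans[OF _ l.card_of_underS_regular[OF x0(2)]])
  have dec': "decomposable \<kappa> I D"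
    if "regular_cardinal \<kappa>" "initial_ordinal l x0 \<le>o \<kappa>" "\<kappa> <o l" for \<kappa> :: "'a rel"
    by (rule dec[OF that(1) ordLeq_transitive[OF l'_x0 that(2)] that(3)])
  have product: "escaping_product l x0 A (set_filter I D) (set_filter A E)" if "pp_pair l A E" for A E
    by (rule escaping_product_pp_pair[OF l U assms(3) x0(1,2) dec' that])
  obtain A E where AE: "pp_pair l A E" using pp_pair_exists[OF l] by blast
  interpret escaping_product l x0 A "set_filter I D" "set_filter A E" by (rule product[OF AE])
  have "decomposable (cardSuc l) I D"
    using escape_L decomposableI[OF U regular_L] by blast
  moreover have "pp l =o cardSuc l"
  proof -
    define R where "R = {cofinality (ultraproduct A E (initial_ordinal l)) | A E. pp_pair l A E}"
    have R: "Card_order s \<and> s =o cardSuc l" if s: "s \<in> R" for s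
    proof -
      obtain A' E' where "pp_pair l A' E'" "s = cofinality (ultraproduct A' E' (initial_ordinal l))"
        using s unfolding R_def by blast
      thus ?thesis
        using cofinality_ultraproduct[OF product[of A' E']] unfolding pp_pair_def by blast
    qed
    have R_Card: "\<forall>s\<in>R. Card_order s" using R by blast
    have "cardinal_Sup R \<le>o cardSuc l"
      using R by (intro cardinal_Sup_least[OF R_Card Card_L]) (auto intro: ordIso_imp_ordLeq)
    moreover have "cardSuc l \<le>o cardinal_Sup R"
    proof -
      \<comment> \<open>Every member of \<open>R\<close> is \<open>\<lambda>\<^sup>+\<close>, so a
        single one suffices for the lower bound.\<close>
      obtain s where s: "s \<in> R" using AE unfolding R_def by blast
      have "cardSuc l =o s" using R[OF s] ordIso_symmetric by blast
      thus ?thesis using cardinal_Sup_upper[OF R_Card s] by (rule ordIso_ordLeq_trans)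
    qed
    ultimately show ?thesis unfolding pp_def R_def ordIso_iff_ordLeq by blast
  qed
  ultimately show ?thesis ..
qed

end
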